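(* Let $\Omega$ be a bounded domain, $\alpha\in(0,1)$, $\rho\in\mathbb{C}$, $T>0$, and assume $U$ is bounded in $\bar\Omega$. Let $G_0\in L^2(\Omega)$ and let $G(t)=G(\cdot,\rho,t)$ be the solution of $$\begin{cases} {}^C_0D^{\alpha,x_0}_t G(x_0,\rho,t)=\Delta G(x_0,\rho,t), & (x_0,t)\in\Omega\times(0,T],\\ G(x_0,\rho,0)=G_0(x_0), & x_0\in\Omega,\\ G(x_0,\rho,t)=0, & (x_0,t)\in\partial\Omega\times(0,T].\end{cases}$$ Then there is a constant $C>0$, independent of $t$ and $G_0$, such that for all $\sigma\in[0,2]$ and $t\in(0,T]$ $$\|G(t)\|_{\dot H^{\sigma}(\Omega)}\le C\,t^{-\sigma\alpha/2}\,\|G_0\|_{L^2(\Omega)}.$$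
   Context: All functions are complex valued. ${}^C_0D^{\alpha,x_0}_t$ is the Caputo fractional substantial derivative: ${}^C_0D^{\alpha,x_0}_tG(x_0,\rho,t)=e^{-t\rho U(x_0)}\;{}^C_0D^{\alpha}_t\big(e^{t\rho U(x_0)}G(x_0,\rho,t)\big)$, where ${}^C_0D^\alpha_t g(t)=\frac{1}{\Gamma(1-\alpha)}\int_0^t(t-\xi)^{-\alpha}g'(\xi)\,d\xi$. $A=-\Delta$ with zero Dirichlet boundary condition, with eigenvalues $\lambda_j$ (ordered non-decreasingly) and $L^2(\Omega)$-normalized eigenfunctions $\varphi_j$. For $r\ge0$, $\dot H^r(\Omega)=\{v\in L^2(\Omega):A^{r/2}v\in L^2(\Omega)\}$ with $\|v\|_{\dot H^r(\Omega)}^2=\sum_{j\ge1}\lambda_j^r|(v,\varphi_j)|^2$. Meaning of the solution: put $\beta(z)=\beta(z,x_0)=z+\rho U(x_0)$; $\beta(z)$ and its (principal) powers act as multiplication operators in $x_0$. The Laplace transform in time of the solution is $\tilde G(z)=((\beta(z))^{\alpha}+A)^{-1}(\beta(z))^{\alpha-1}G_0$, i.e. $$G(t)=\frac{1}{2\pi\mathbf i}\int_{\Gamma_{\theta,\kappa}}e^{zt}((\beta(z))^{\alpha}+A)^{-1}(\beta(z))^{\alpha-1}G_0\,dz,$$ where $\Gamma_{\theta,\kappa}=\{|z|=\kappa,|\arg z|\le\theta\}\cup\{z=re^{\pm\mathbf i\theta}:r\ge\kappa\}$, oriented with increasing imaginary part, with $\theta\in(\pi/2,\pi)$ sufficiently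 close to $\pi/2$ and $\kappa>0$ sufficiently large (depending on $|\rho|\,\|U\|_{L^\infty(\bar\Omega)}$). *)

theory Defs
  imports "HOL-Complex_Analysis.Complex_Analysis"
begin

section \<open>The space \<open>L\<^sup>2(\<Omega>)\<close>\<close>

text \<open>Elements of \<open>L\<^sup>2(\<Omega>)\<close> are represented by complex-valued functions; equality in
  \<open>L\<^sup>2(\<Omega>)\<close> is equality almost everywhere in \<open>\<Omega>\<close>, and values outside \<open>\<Omega>\<close> are irrelevant.\<close>

definition L2 :: "'a::euclidean_space set \<Rightarrow> ('a \<Rightarrow> complex) set" where
  "L2 \<Omega> = {u \<in> borel_measurable (lebesgue_on \<Omega>). integrable (lebesgue_on \<Omega>) (\<lambda>x. (cmod (u x))\<^sup>2)}"

definition L2_inner :: "'a::euclidean_space set \<Rightarrow> ('a \<Rightarrow> complex) \<Rightarrow> ('a \<Rightarrow> complex) \<Rightarrow> complex" where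
  "L2_inner \<Omega> u v = (LINT x|lebesgue_on \<Omega>. u x * cnj (v x))"

definition L2_norm :: "'a::euclidean_space set \<Rightarrow> ('a \<Rightarrow> complex) \<Rightarrow> real" where
  "L2_norm \<Omega> u = sqrt (LINT x|lebesgue_on \<Omega>. (cmod (u x))\<^sup>2)"


section \<open>The Dirichlet Laplacian\<close>

definition partial_deriv :: "'a::euclidean_space \<Rightarrow> ('a \<Rightarrow> complex) \<Rightarrow> 'a \<Rightarrow> complex" where
  "partial_deriv b f = (\<lambda>x. frechet_derivative f (at x) b)"

text \<open>\<open>C\<^sup>\<infinity>\<close>, as the largest class of differentiable functions that is closed under taking partial
  derivatives.\<close>

coinductive smooth :: "('a::euclidean_space \<Rightarrow> complex) \<Rightarrow> bool" where
  "\<lbrakk>f differentiable_on UNIV; \<forall>b\<in>Basis. smooth (partial_deriv b f)\<rbrakk> \<Longrightarrow> smooth f"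

definition test_functions :: "'a::euclidean_space set \<Rightarrow> ('a \<Rightarrow> complex) set" where
  "test_functions \<Omega> = {\<psi>. smooth \<psi> \<and> compact (closure {x. \<psi> x \<noteq> 0}) \<and> closure {x. \<psi> x \<noteq> 0} \<subseteq> \<Omega>}"

text \<open>\<open>H10_grad \<Omega> v g\<close>: \<open>v\<close> lies in \<open>H\<^sup>1\<^sub>0(\<Omega>)\<close>, the closure of the test functions in
  \<open>H\<^sup>1(\<Omega>)\<close>, and \<open>g b\<close> is its weak partial derivative in the coordinate direction \<open>b\<close>.\<close>

definition H10_grad ::
  "'a::euclidean_space set \<Rightarrow> ('a \<Rightarrow> complex) \<Rightarrow> ('a \<Rightarrow> 'a \<Rightarrow> complex) \<Rightarrow> bool" where
  "H10_grad \<Omega> v g \<longleftrightarrow>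
     v \<in> L2 \<Omega> \<and> (\<forall>b\<in>Basis. g b \<in> L2 \<Omega>) \<and>
     (\<exists>\<psi> :: nat \<Rightarrow> 'a \<Rightarrow> complex.
        (\<forall>n. \<psi> n \<in> test_functions \<Omega>) \<and>
        (\<lambda>n. L2_norm \<Omega> (\<lambda>x. \<psi> n x - v x)) \<longlonglongrightarrow> 0 \<and>
        (\<forall>b\<in>Basis. (\<lambda>n. L2_norm \<Omega> (\<lambda>x. partial_deriv b (\<psi> n) x - g b x)) \<longlonglongrightarrow> 0))"

text \<open>The graph of \<open>A = -\<Delta>\<close> with zero Dirichlet condition, as an unbounded operator in
  \<open>L\<^sup>2(\<Omega>)\<close>: \<open>v\<close> is in the domain and \<open>A v = f\<close>. No regularity of the boundary is used.\<close>

definition dirichlet_laplacian ::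
  "'a::euclidean_space set \<Rightarrow> ('a \<Rightarrow> complex) \<Rightarrow> ('a \<Rightarrow> complex) \<Rightarrow> bool" where
  "dirichlet_laplacian \<Omega> v f \<longleftrightarrow>
     f \<in> L2 \<Omega> \<and>
     (\<exists>g. H10_grad \<Omega> v g \<and>
          (\<forall>\<psi>\<in>test_functions \<Omega>.
             (\<Sum>b\<in>Basis. L2_inner \<Omega> (g b) (partial_deriv b \<psi>)) = L2_inner \<Omega> f \<psi>))"

text \<open>All eigenvalues of \<open>A\<close>, in non-decreasing order and repeated according to multiplicity, with
  orthonormal eigenfunctions (indexed from \<open>0\<close>). The last clause says that none is missing: an
  eigenfunction orthogonal to all \<open>\<phi> j\<close> vanishes. Completeness of \<open>\<phi>\<close> in \<open>L\<^sup>2(\<Omega>)\<close> is not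
  postulated; it follows by the spectral theorem.\<close>

definition dirichlet_eigensystem ::
  "'a::euclidean_space set \<Rightarrow> (nat \<Rightarrow> real) \<Rightarrow> (nat \<Rightarrow> 'a \<Rightarrow> complex) \<Rightarrow> bool" where
  "dirichlet_eigensystem \<Omega> lam \<phi> \<longleftrightarrow>
     mono lam \<and>
     (\<forall>j. dirichlet_laplacian \<Omega> (\<phi> j) (\<lambda>x. of_real (lam j) * \<phi> j x)) \<and>
     (\<forall>i j. L2_inner \<Omega> (\<phi> i) (\<phi> j) = (if i = j then 1 else 0)) \<and>
     (\<forall>\<mu> v. dirichlet_laplacian \<Omega> v (\<lambda>x. \<mu> * v x) \<and> (\<forall>j. L2_inner \<Omega> v (\<phi> j) = 0)
            \<longrightarrow> (AE x in lebesgue_on \<Omega>. v x = 0))"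

definition Hdot ::
  "'a::euclidean_space set \<Rightarrow> (nat \<Rightarrow> real) \<Rightarrow> (nat \<Rightarrow> 'a \<Rightarrow> complex) \<Rightarrow> real \<Rightarrow> ('a \<Rightarrow> complex) set" where
  "Hdot \<Omega> lam \<phi> r =
     {v \<in> L2 \<Omega>. summable (\<lambda>j. lam j powr r * (cmod (L2_inner \<Omega> v (\<phi> j)))\<^sup>2)}"

definition Hdot_norm ::
  "'a::euclidean_space set \<Rightarrow> (nat \<Rightarrow> real) \<Rightarrow> (nat \<Rightarrow> 'a \<Rightarrow> complex) \<Rightarrow> real \<Rightarrow> ('a \<Rightarrow> complex) \<Rightarrow> real" where
  "Hdot_norm \<Omega> lam \<phi> r v =
     sqrt (\<Sum>j. lam j powr r * (cmod (L2_inner \<Omega> v (\<phi> j)))\<^sup>2)"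


section \<open>Integrals along \<open>\<Gamma>\<^bsub>\<theta>,\<kappa>\<^esub>\<close>\<close>

text \<open>The contour comes in from infinity along the ray of argument \<open>-\<theta>\<close>, follows the arc of radius
  \<open>\<kappa>\<close> counterclockwise, and leaves along the ray of argument \<open>\<theta>\<close>.\<close>

definition hankel_integrable :: "real \<Rightarrow> real \<Rightarrow> (complex \<Rightarrow> complex) \<Rightarrow> bool" where
  "hankel_integrable \<theta> \<kappa> f \<longleftrightarrow>
     set_integrable lborel {\<kappa>..} (\<lambda>r. f (rcis r \<theta>) * cis \<theta>) \<and>
     set_integrable lborel {\<kappa>..} (\<lambda>r. f (rcis r (-\<theta>)) * cis (-\<theta>)) \<and>
     f contour_integrable_on part_circlepath 0 \<kappa> (-\<theta>) \<theta>"

definition hankel_integral :: "real \<Rightarrow> real \<Rightarrow> (complex \<Rightarrow> complex) \<Rightarrow> complex" where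
  "hankel_integral \<theta> \<kappa> f =
     contour_integral (part_circlepath 0 \<kappa> (-\<theta>) \<theta>) f
     + (LINT r:{\<kappa>..}|lborel. f (rcis r \<theta>) * cis \<theta>)
     - (LINT r:{\<kappa>..}|lborel. f (rcis r (-\<theta>)) * cis (-\<theta>))"

definition sector :: "real \<Rightarrow> real \<Rightarrow> complex set" where
  "sector \<theta> \<kappa> = {z. \<kappa> \<le> cmod z \<and> \<bar>Arg z\<bar> \<le> \<theta>}"


section \<open>The solution\<close>

definition beta :: "('a \<Rightarrow> complex) \<Rightarrow> complex \<Rightarrow> complex \<Rightarrow> 'a \<Rightarrow> complex" where
  "beta U \<rho> z x = z + \<rho> * U x"

text \<open>\<open>w = (\<beta>(z)\<^sup>\<alpha> + A)\<^sup>-\<^sup>1 \<beta>(z)\<^sup>\<alpha>\<^sup>-\<^sup>1 G0\<close>, with the inverse read as that of the operator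
  \<open>\<beta>(z)\<^sup>\<alpha> + A\<close> on the domain of \<open>A\<close>: \<open>w\<close> is in that domain and
  \<open>A w = \<beta>(z)\<^sup>\<alpha>\<^sup>-\<^sup>1 G0 - \<beta>(z)\<^sup>\<alpha> w\<close>. Complex \<open>powr\<close> is the principal power.\<close>

definition laplace_solution ::
  "'a::euclidean_space set \<Rightarrow> ('a \<Rightarrow> complex) \<Rightarrow> real \<Rightarrow> complex \<Rightarrow> ('a \<Rightarrow> complex) \<Rightarrow>
   complex \<Rightarrow> ('a \<Rightarrow> complex) \<Rightarrow> bool" where
  "laplace_solution \<Omega> U \<alpha> \<rho> G0 z w \<longleftrightarrow>
     dirichlet_laplacian \<Omega> w
       (\<lambda>x. beta U \<rho> z x powr of_real (\<alpha> - 1) * G0 x - beta U \<rho> z x powr of_real \<alpha> * w x)"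

text \<open>\<open>G\<close> is the solution on \<open>(0, T]\<close> with initial value \<open>G0\<close>: the inverse Laplace transform, along
  \<open>\<Gamma>\<^bsub>\<theta>,\<kappa>\<^esub>\<close>, of the transform \<open>w\<close>, which is a function on the sector whose boundary is this
  contour. The \<open>L\<^sup>2(\<Omega>)\<close>-valued integral is the usual vector-valued one, i.e. it is determined by its
  pairings with the elements of \<open>L\<^sup>2(\<Omega>)\<close>.\<close>

definition is_solution ::
  "'a::euclidean_space set \<Rightarrow> ('a \<Rightarrow> complex) \<Rightarrow> real \<Rightarrow> complex \<Rightarrow> real \<Rightarrow> real \<Rightarrow> real \<Rightarrow>
   ('a \<Rightarrow> complex) \<Rightarrow> (real \<Rightarrow> 'a \<Rightarrow> complex) \<Rightarrow> bool" where
  "is_solution \<Omega> U \<alpha> \<rho> T \<theta> \<kappa> G0 G \<longleftrightarrow>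
     (\<exists>w. (\<forall>z\<in>sector \<theta> \<kappa>. laplace_solution \<Omega> U \<alpha> \<rho> G0 z (w z)) \<and>
          (\<forall>t\<in>{0<..T}. G t \<in> L2 \<Omega> \<and>
             (\<forall>\<psi>\<in>L2 \<Omega>.
                hankel_integrable \<theta> \<kappa> (\<lambda>z. exp (z * of_real t) * L2_inner \<Omega> (w z) \<psi>) \<and>
                L2_inner \<Omega> (G t) \<psi> =
                  1 / (2 * of_real pi * \<i>) *
                  hankel_integral \<theta> \<kappa> (\<lambda>z. exp (z * of_real t) * L2_inner \<Omega> (w z) \<psi>))))"

end

theory Submission
  imports Defs
begin

text \<open>The form \<open>(\<beta>(z) powr \<alpha> w, w) + \<parallel>\<nabla>w\<parallel>\<^sup>2\<close> is coercive on the sector, because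
  \<open>\<beta>(z)\<close> has argument below \<open>pi / (2 * \<alpha>)\<close> there. Hence \<open>\<parallel>w(z)\<parallel> = O(1 / |z|)\<close> and
  \<open>\<parallel>A w(z)\<parallel> = O(|z| powr (\<alpha> - 1))\<close>. Pairings of \<open>w\<close> with elements of \<open>L\<^sup>2\<close> are holomorphic, so the
  radius of the contour may be raised to \<open>1 / t\<close>; the integral then gives \<open>\<parallel>G(t)\<parallel> = O(1)\<close> and
  \<open>\<parallel>A G(t)\<parallel> = O(t powr (- \<alpha>))\<close>, and the cases \<open>0 < \<sigma> < 2\<close> follow by interpolating between the
  two bounds on the eigenfunction coefficients.\<close>

subsection \<open>The space \<open>L\<^sup>2\<close>\<close>

text \<open>The factor \<open>beta U \<rho> z x\<close> depends on x, and multiplication by its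
  powers does not commute with A. So the eigenfunctions do not diagonalize the resolvent, and its
  bounds must come from the energy form rather than from scalar estimates for each eigenvalue. The
  eigenfunctions enter only at the end, where the norm of G(t) is read off.

  A is never applied to G(t) itself, which would call for a closedness argument under the contour
  integral. Instead G(t) is paired with finite combinations of the \<open>\<phi> j\<close>, on which
  A acts explicitly, and symmetry moves A onto w(z) inside the integral.

  The half-angle \<open>pi / (1 + \<alpha>)\<close> meets two demands: it exceeds pi / 2, which
  leaves room for \<theta> and for the shift by \<rho> U, and \<alpha> times it stays below pi / 2,
  which makes the powers coercive. Both amount to \<alpha> < 1.\<close>

lemma L2_measurable: "u \<in> L2 \<Omega> \<Longrightarrow> u \<in> borel_measurable (lebesgue_on \<Omega>)"
  and L2_square_integrable: "u \<in> L2 \<Omega> \<Longrightarrow> integrable (lebesgue_on \<Omega>) (\<lambda>x. (cmod (u x))\<^sup>2)"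
  by (auto simp: L2_def)

lemma L2_norm_nonneg [simp]: "0 \<le> L2_norm \<Omega> u"
  by (simp add: L2_norm_def)

lemma L2_norm_square: "(L2_norm \<Omega> u)\<^sup>2 = (LINT x|lebesgue_on \<Omega>. (cmod (u x))\<^sup>2)"
  by (simp add: L2_norm_def)

lemma borel_measurable_cnj [measurable (raw)]:
  "f \<in> borel_measurable M \<Longrightarrow> (\<lambda>x. cnj (f x)) \<in> borel_measurable M"
  by (rule borel_measurable_continuous_on[OF _ , of cnj]) (auto intro!: continuous_intros)

lemma integrable_L2_inner:
  assumes "u \<in> L2 \<Omega>" "v \<in> L2 \<Omega>"
  shows "integrable (lebesgue_on \<Omega>) (\<lambda>x. u x * cnj (v x))"
proof (rule Bochner_Integration.integrable_bound)
  show "integrable (lebesgue_on \<Omega>) (\<lambda>x. (cmod (u x))\<^sup>2 + (cmod (v x))\<^sup>2)"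
    using assms by (intro Bochner_Integration.integrable_add L2_square_integrable)
  show "(\<lambda>x. u x * cnj (v x)) \<in> borel_measurable (lebesgue_on \<Omega>)"
    using assms[THEN L2_measurable] by measurable
  have "a * b \<le> a\<^sup>2 + b\<^sup>2" if "0 \<le> a" "0 \<le> b" for a b :: real
    using sum_squares_bound[of a b] mult_nonneg_nonneg[OF that] by linarith
  then show "AE x in lebesgue_on \<Omega>.
      norm (u x * cnj (v x)) \<le> norm ((cmod (u x))\<^sup>2 + (cmod (v x))\<^sup>2)"
    by (simp add: norm_mult)
qed

lemma L2_dominated:
  assumes "v \<in> L2 \<Omega>" "u \<in> borel_measurable (lebesgue_on \<Omega>)" "0 \<le> K"
    and "\<And>x. x \<in> \<Omega> \<Longrightarrow> cmod (u x) \<le> K * cmod (v x)"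
  shows "u \<in> L2 \<Omega>" and "L2_norm \<Omega> u \<le> K * L2_norm \<Omega> v"
proof -
  have le: "(cmod (u x))\<^sup>2 \<le> K\<^sup>2 * (cmod (v x))\<^sup>2" if "x \<in> \<Omega>" for x
    using power_mono[OF assms(4)[OF that] norm_ge_zero, of 2] by (simp add: power_mult_distrib)
  have int: "integrable (lebesgue_on \<Omega>) (\<lambda>x. K\<^sup>2 * (cmod (v x))\<^sup>2)"
    using L2_square_integrable[OF assms(1)] by simp
  have int': "integrable (lebesgue_on \<Omega>) (\<lambda>x. (cmod (u x))\<^sup>2)"
  proof (rule Bochner_Integration.integrable_bound[OF int])
    show "(\<lambda>x. (cmod (u x))\<^sup>2) \<in> borel_measurable (lebesgue_on \<Omega>)"
      using assms(2) by measurable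
    show "AE x in lebesgue_on \<Omega>. norm ((cmod (u x))\<^sup>2) \<le> norm (K\<^sup>2 * (cmod (v x))\<^sup>2)"
      by (rule AE_I2) (simp add: space_restrict_space abs_mult le)
  qed
  then show "u \<in> L2 \<Omega>"
    using assms(2) by (simp add: L2_def)
  have "(L2_norm \<Omega> u)\<^sup>2 \<le> (LINT x|lebesgue_on \<Omega>. K\<^sup>2 * (cmod (v x))\<^sup>2)"
    unfolding L2_norm_square
    by (rule integral_mono[OF int' int]) (simp add: space_restrict_space le)
  also have "\<dots> = (K * L2_norm \<Omega> v)\<^sup>2"
    by (simp add: power_mult_distrib L2_norm_square)
  finally show "L2_norm \<Omega> u \<le> K * L2_norm \<Omega> v"
    by (rule power2_le_imp_le) (simp add: \<open>0 \<le> K\<close>)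
qed

lemma L2_mult_bounded:
  assumes "v \<in> L2 \<Omega>" "m \<in> borel_measurable (lebesgue_on \<Omega>)" "0 \<le> K"
    and "\<And>x. x \<in> \<Omega> \<Longrightarrow> cmod (m x) \<le> K"
  shows "(\<lambda>x. m x * v x) \<in> L2 \<Omega>" and "L2_norm \<Omega> (\<lambda>x. m x * v x) \<le> K * L2_norm \<Omega> v"
proof -
  have m: "(\<lambda>x. m x * v x) \<in> borel_measurable (lebesgue_on \<Omega>)"
    using assms(2) L2_measurable[OF assms(1)] by measurable
  have le: "cmod (m x * v x) \<le> K * cmod (v x)" if "x \<in> \<Omega>" for x
    using assms(4)[OF that] by (simp add: norm_mult mult_right_mono)
  show "(\<lambda>x. m x * v x) \<in> L2 \<Omega>" "L2_norm \<Omega> (\<lambda>x. m x * v x) \<le> K * L2_norm \<Omega> v"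
    using L2_dominated[OF assms(1) m assms(3) le] by simp_all
qed

lemma L2_scale: "u \<in> L2 \<Omega> \<Longrightarrow> (\<lambda>x. a * u x) \<in> L2 \<Omega>"
  by (rule L2_mult_bounded(1)[where K = "cmod a"]) auto

lemma L2_add:
  assumes "u \<in> L2 \<Omega>" "v \<in> L2 \<Omega>"
  shows "(\<lambda>x. u x + v x) \<in> L2 \<Omega>"
proof -
  have meas: "(\<lambda>x. u x + v x) \<in> borel_measurable (lebesgue_on \<Omega>)"
    using assms[THEN L2_measurable] by measurable
  have "integrable (lebesgue_on \<Omega>) (\<lambda>x. (cmod (u x + v x))\<^sup>2)"
  proof (rule Bochner_Integration.integrable_bound)
    show "integrable (lebesgue_on \<Omega>) (\<lambda>x. 2 * (cmod (u x))\<^sup>2 + 2 * (cmod (v x))\<^sup>2)"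
      using assms by (intro Bochner_Integration.integrable_add integrable_mult_right L2_square_integrable)
    show "(\<lambda>x. (cmod (u x + v x))\<^sup>2) \<in> borel_measurable (lebesgue_on \<Omega>)"
      using meas by measurable
    have "(cmod (a + b))\<^sup>2 \<le> 2 * (cmod a)\<^sup>2 + 2 * (cmod b)\<^sup>2" for a b
    proof -
      have "(cmod (a + b))\<^sup>2 \<le> (cmod a + cmod b)\<^sup>2"
        by (intro power_mono norm_triangle_ineq) auto
      then show ?thesis
        using sum_squares_bound[of "cmod a" "cmod b"] by (simp add: power2_sum)
    qed
    then show "AE x in lebesgue_on \<Omega>. norm ((cmod (u x + v x))\<^sup>2)
        \<le> norm (2 * (cmod (u x))\<^sup>2 + 2 * (cmod (v x))\<^sup>2)"
      by simp
  qed
  with meas show ?thesis by (simp add: L2_def)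
qed

lemma L2_diff: "u \<in> L2 \<Omega> \<Longrightarrow> v \<in> L2 \<Omega> \<Longrightarrow> (\<lambda>x. u x - v x) \<in> L2 \<Omega>"
  using L2_add[of u \<Omega> "\<lambda>x. - 1 * v x"] L2_scale[of v \<Omega> "- 1"] by simp

lemma L2_zero [simp]: "(\<lambda>x. 0) \<in> L2 \<Omega>"
  by (simp add: L2_def)

lemma L2_sum: "(\<And>i. i \<in> I \<Longrightarrow> u i \<in> L2 \<Omega>) \<Longrightarrow> (\<lambda>x. \<Sum>i\<in>I. u i x) \<in> L2 \<Omega>"
  by (induction I rule: infinite_finite_induct) (auto intro: L2_add)

lemma cnj_L2_inner: "cnj (L2_inner \<Omega> u v) = L2_inner \<Omega> v u"
proof -
  have "cnj (L2_inner \<Omega> u v) = (LINT x|lebesgue_on \<Omega>. cnj (u x * cnj (v x)))"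
    unfolding L2_inner_def by (rule Bochner_Integration.integral_cnj[symmetric])
  then show ?thesis
    by (simp add: L2_inner_def mult.commute)
qed

lemma L2_inner_add_left:
  "u \<in> L2 \<Omega> \<Longrightarrow> v \<in> L2 \<Omega> \<Longrightarrow> w \<in> L2 \<Omega> \<Longrightarrow>
     L2_inner \<Omega> (\<lambda>x. u x + v x) w = L2_inner \<Omega> u w + L2_inner \<Omega> v w"
  unfolding L2_inner_def by (simp add: distrib_right integrable_L2_inner)

lemma L2_inner_diff_left:
  "u \<in> L2 \<Omega> \<Longrightarrow> v \<in> L2 \<Omega> \<Longrightarrow> w \<in> L2 \<Omega> \<Longrightarrow>
     L2_inner \<Omega> (\<lambda>x. u x - v x) w = L2_inner \<Omega> u w - L2_inner \<Omega> v w"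
  unfolding L2_inner_def by (simp add: left_diff_distrib integrable_L2_inner)

lemma L2_inner_scale_left: "L2_inner \<Omega> (\<lambda>x. a * u x) v = a * L2_inner \<Omega> u v"
  unfolding L2_inner_def by (simp add: mult.assoc)

lemma L2_inner_add_right:
  "u \<in> L2 \<Omega> \<Longrightarrow> v \<in> L2 \<Omega> \<Longrightarrow> w \<in> L2 \<Omega> \<Longrightarrow>
     L2_inner \<Omega> w (\<lambda>x. u x + v x) = L2_inner \<Omega> w u + L2_inner \<Omega> w v"
  unfolding L2_inner_def by (simp add: distrib_left integrable_L2_inner)

lemma L2_inner_diff_right:
  "u \<in> L2 \<Omega> \<Longrightarrow> v \<in> L2 \<Omega> \<Longrightarrow> w \<in> L2 \<Omega> \<Longrightarrow>
     L2_inner \<Omega> w (\<lambda>x. u x - v x) = L2_inner \<Omega> w u - L2_inner \<Omega> w v"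
  unfolding L2_inner_def by (simp add: right_diff_distrib integrable_L2_inner)

lemma L2_inner_scale_right: "L2_inner \<Omega> u (\<lambda>x. a * v x) = cnj a * L2_inner \<Omega> u v"
  unfolding L2_inner_def by (simp add: mult.left_commute)

lemma L2_inner_sum_left:
  assumes "\<And>i. i \<in> I \<Longrightarrow> u i \<in> L2 \<Omega>" "w \<in> L2 \<Omega>"
  shows "L2_inner \<Omega> (\<lambda>x. \<Sum>i\<in>I. u i x) w = (\<Sum>i\<in>I. L2_inner \<Omega> (u i) w)"
  using assms
  by (induction I rule: infinite_finite_induct)
     (auto simp: L2_inner_add_left L2_sum, simp_all add: L2_inner_def)

lemma L2_inner_sum_right:
  assumes "\<And>i. i \<in> I \<Longrightarrow> u i \<in> L2 \<Omega>" "w \<in> L2 \<Omega>"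
  shows "L2_inner \<Omega> w (\<lambda>x. \<Sum>i\<in>I. u i x) = (\<Sum>i\<in>I. L2_inner \<Omega> w (u i))"
  using assms
  by (induction I rule: infinite_finite_induct)
     (auto simp: L2_inner_add_right L2_sum, simp_all add: L2_inner_def)

lemma L2_inner_self: "L2_inner \<Omega> u u = of_real ((L2_norm \<Omega> u)\<^sup>2)"
  unfolding L2_inner_def L2_norm_square integral_complex_of_real[symmetric]
  by (simp only: complex_norm_square)

lemma L2_norm_scale: "L2_norm \<Omega> (\<lambda>x. a * u x) = cmod a * L2_norm \<Omega> u"
  unfolding L2_norm_def by (simp add: norm_mult power_mult_distrib real_sqrt_mult)

lemma L2_norm_add_square:
  assumes "u \<in> L2 \<Omega>" "v \<in> L2 \<Omega>"
  shows "(L2_norm \<Omega> (\<lambda>x. u x + v x))\<^sup>2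
           = (L2_norm \<Omega> u)\<^sup>2 + 2 * Re (L2_inner \<Omega> u v) + (L2_norm \<Omega> v)\<^sup>2"
proof -
  have "L2_inner \<Omega> (\<lambda>x. u x + v x) (\<lambda>x. u x + v x)
      = L2_inner \<Omega> u u + (L2_inner \<Omega> u v + cnj (L2_inner \<Omega> u v)) + L2_inner \<Omega> v v"
    using assms by (simp add: L2_inner_add_left L2_inner_add_right L2_add cnj_L2_inner)
  then show ?thesis
    unfolding L2_inner_self complex_add_cnj by (simp only: of_real_add[symmetric] of_real_eq_iff)
qed

text \<open>The squared norm of \<open>u - s b v\<close> is nonnegative for every real
  \<open>s\<close>, where \<open>b\<close> is the inner product. Since \<open>L2_norm\<close> is
  only a seminorm on functions, a \<open>v\<close> of norm zero is a genuine separate case.\<close>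

lemma L2_Cauchy_Schwarz:
  assumes "u \<in> L2 \<Omega>" "v \<in> L2 \<Omega>"
  shows "cmod (L2_inner \<Omega> u v) \<le> L2_norm \<Omega> u * L2_norm \<Omega> v"
proof -
  define b where "b = L2_inner \<Omega> u v"
  define p where "p = (cmod b)\<^sup>2"
  have expand: "0 \<le> (L2_norm \<Omega> u)\<^sup>2 - 2 * s * p + s\<^sup>2 * p * (L2_norm \<Omega> v)\<^sup>2" for s :: real
  proof -
    have "0 \<le> (L2_norm \<Omega> (\<lambda>x. u x + (- of_real s * b) * v x))\<^sup>2"
      by simp
    also have "\<dots> = (L2_norm \<Omega> u)\<^sup>2 + 2 * Re (cnj (- of_real s * b) * b)
        + (cmod (- of_real s * b) * L2_norm \<Omega> v)\<^sup>2"
      unfolding L2_norm_add_square[OF assms(1) L2_scale[OF assms(2)]]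
        L2_inner_scale_right L2_norm_scale b_def[symmetric] ..
    also have "Re (cnj (- of_real s * b) * b) = - s * p"
      unfolding p_def cmod_power2 by (simp add: algebra_simps power2_eq_square)
    also have "(cmod (- of_real s * b) * L2_norm \<Omega> v)\<^sup>2 = s\<^sup>2 * p * (L2_norm \<Omega> v)\<^sup>2"
      by (simp add: p_def norm_mult power_mult_distrib)
    finally show ?thesis by simp
  qed
  have "p \<le> (L2_norm \<Omega> u * L2_norm \<Omega> v)\<^sup>2"
  proof (cases "L2_norm \<Omega> v = 0")
    case True
    \<comment> \<open>The expression in \<open>expand\<close> is now affine in \<open>s\<close> with
      slope \<open>- 2 * p\<close>, so a large \<open>s\<close> makes it negative unless
      \<open>p\<close> vanishes.\<close>
    have "p = 0"
    proof (rule ccontr)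
      assume "p \<noteq> 0"
      then have "2 * (((L2_norm \<Omega> u)\<^sup>2 + 1) / p) * p = 2 * ((L2_norm \<Omega> u)\<^sup>2 + 1)"
        by simp
      with expand[of "((L2_norm \<Omega> u)\<^sup>2 + 1) / p"] True
      have "0 \<le> (L2_norm \<Omega> u)\<^sup>2 - 2 * ((L2_norm \<Omega> u)\<^sup>2 + 1)"
        by (simp only:) simp
      moreover have "q < 2 * (q + 1)" if "0 \<le> q" for q :: real
        using that by simp
      ultimately show False
        by (metis diff_ge_0_iff_ge not_less zero_le_power2)
    qed
    then show ?thesis by simp
  next
    case False
    \<comment> \<open>The choice of \<open>s\<close> is the minimizer of the quadratic.\<close>
    have "0 \<le> (L2_norm \<Omega> u)\<^sup>2 - p / (L2_norm \<Omega> v)\<^sup>2"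
      using expand[of "1 / (L2_norm \<Omega> v)\<^sup>2"] False by (simp add: field_simps power2_eq_square)
    then show ?thesis
      using False by (simp add: field_simps power_mult_distrib)
  qed
  then show ?thesis
    unfolding p_def b_def by (rule power2_le_imp_le) simp
qed

lemma L2_norm_triangle:
  assumes "u \<in> L2 \<Omega>" "v \<in> L2 \<Omega>"
  shows "L2_norm \<Omega> (\<lambda>x. u x + v x) \<le> L2_norm \<Omega> u + L2_norm \<Omega> v"
proof (rule power2_le_imp_le)
  have "Re (L2_inner \<Omega> u v) \<le> L2_norm \<Omega> u * L2_norm \<Omega> v"
    using L2_Cauchy_Schwarz[OF assms] complex_Re_le_cmod order_trans by blast
  then show "(L2_norm \<Omega> (\<lambda>x. u x + v x))\<^sup>2 \<le> (L2_norm \<Omega> u + L2_norm \<Omega> v)\<^sup>2"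
    unfolding L2_norm_add_square[OF assms] by (simp add: power2_sum)
qed simp

lemma L2_norm_triangle_diff:
  assumes "u \<in> L2 \<Omega>" "v \<in> L2 \<Omega>"
  shows "L2_norm \<Omega> (\<lambda>x. u x - v x) \<le> L2_norm \<Omega> u + L2_norm \<Omega> v"
  using L2_norm_triangle[OF assms(1) L2_scale[OF assms(2)], of "-1"] L2_norm_scale[of \<Omega> "-1" v]
  by simp

lemma tendsto_L2_inner_right:
  assumes "u \<in> L2 \<Omega>" "v \<in> L2 \<Omega>" "\<And>n. \<psi> n \<in> L2 \<Omega>"
    and "(\<lambda>n. L2_norm \<Omega> (\<lambda>x. \<psi> n x - v x)) \<longlonglongrightarrow> 0"
  shows "(\<lambda>n. L2_inner \<Omega> u (\<psi> n)) \<longlonglongrightarrow> L2_inner \<Omega> u v"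
proof (rule Lim_null[THEN iffD2], rule Lim_null_comparison)
  show "(\<lambda>n. L2_norm \<Omega> u * L2_norm \<Omega> (\<lambda>x. \<psi> n x - v x)) \<longlonglongrightarrow> 0"
    using tendsto_mult_right_zero[OF assms(4)] .
  have "norm (L2_inner \<Omega> u (\<psi> n) - L2_inner \<Omega> u v)
      \<le> L2_norm \<Omega> u * L2_norm \<Omega> (\<lambda>x. \<psi> n x - v x)" for n
    using L2_Cauchy_Schwarz[OF assms(1) L2_diff[OF assms(3)[of n] assms(2)]] assms(1-3)
    by (simp add: L2_inner_diff_right)
  then show "\<forall>\<^sub>F n in sequentially. norm (L2_inner \<Omega> u (\<psi> n) - L2_inner \<Omega> u v)
      \<le> L2_norm \<Omega> u * L2_norm \<Omega> (\<lambda>x. \<psi> n x - v x)"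
    by simp
qed

subsection \<open>The form of the Dirichlet Laplacian\<close>

lemma smooth_imp_differentiable: "smooth f \<Longrightarrow> f differentiable at x"
  by (erule smooth.cases) (simp add: differentiable_on_def)

lemma smooth_imp_continuous: "smooth f \<Longrightarrow> continuous_on S f"
  by (simp add: continuous_at_imp_continuous_on differentiable_imp_continuous_within
      smooth_imp_differentiable)

lemma smooth_partial_deriv: "smooth f \<Longrightarrow> b \<in> Basis \<Longrightarrow> smooth (partial_deriv b f)"
  by (erule smooth.cases) simp

section \<open>Linear combinations of smooth functions and of test functions\<close>

lemma partial_deriv_lincomb:
  assumes "f differentiable at x" "g differentiable at x"
  shows "partial_deriv b (\<lambda>x. c * f x + d * g x) x
           = c * partial_deriv b f x + d * partial_deriv b g x"
proof -
  have "((\<lambda>x. c * f x + d * g x) has_derivative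
      (\<lambda>h. c * frechet_derivative f (at x) h + d * frechet_derivative g (at x) h)) (at x)"
    using assms[unfolded frechet_derivative_works]
    by (intro has_derivative_add has_derivative_mult_right)
  then show ?thesis
    unfolding partial_deriv_def by (simp add: frechet_derivative_at[symmetric])
qed

lemma smooth_lincomb:
  assumes "smooth f" "smooth g"
  shows "smooth (\<lambda>x. c * f x + d * g x)"
proof -
  \<comment> \<open>The coinduction predicate fixes \<open>c\<close> and \<open>d\<close> and lets
    the two smooth functions vary: a partial derivative of such a combination is again one, with the
    same coefficients.\<close>
  define X where "X h \<longleftrightarrow> (\<exists>f g. h = (\<lambda>x. c * f x + d * g x) \<and> smooth f \<and> smooth g)"
    for h :: "'a \<Rightarrow> complex"
  have "X (\<lambda>x. c * f x + d * g x)"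
    unfolding X_def by (rule exI[of _ f], rule exI[of _ g]) (use assms in simp)
  then show ?thesis
  proof (rule smooth.coinduct[where X = X])
    fix h assume "X h"
    then obtain f g where h: "h = (\<lambda>x. c * f x + d * g x)" and f: "smooth f" and g: "smooth g"
      unfolding X_def by blast
    have "h differentiable at x" for x
      unfolding h
      by (intro differentiable_add differentiable_mult differentiable_const
          smooth_imp_differentiable f g)
    moreover have "X (partial_deriv b h)" if "b \<in> Basis" for b
    proof -
      have "partial_deriv b h = (\<lambda>x. c * partial_deriv b f x + d * partial_deriv b g x)"
        unfolding h by (intro ext partial_deriv_lincomb smooth_imp_differentiable f g)
      then show ?thesis
        unfolding X_def using smooth_partial_deriv[OF f that] smooth_partial_deriv[OF g that]
        by (intro exI[of _ "partial_deriv b f"] exI[of _ "partial_deriv b g"]) simp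
    qed
    ultimately show "\<exists>f. h = f \<and> f differentiable_on UNIV
        \<and> (\<forall>b\<in>Basis. X (partial_deriv b f) \<or> smooth (partial_deriv b f))"
      by (intro exI[of _ h]) (simp add: differentiable_on_def differentiable_at_withinI)
  qed
qed

lemma test_functions_lincomb:
  assumes "f \<in> test_functions \<Omega>" "g \<in> test_functions \<Omega>"
  shows "(\<lambda>x. c * f x + d * g x) \<in> test_functions \<Omega>"
proof -
  let ?h = "\<lambda>x. c * f x + d * g x"
  have "{x. ?h x \<noteq> 0} \<subseteq> {x. f x \<noteq> 0} \<union> {x. g x \<noteq> 0}"
    by auto
  then have sub: "closure {x. ?h x \<noteq> 0} \<subseteq> closure {x. f x \<noteq> 0} \<union> closure {x. g x \<noteq> 0}"
    unfolding closure_Un[symmetric] by (rule closure_mono)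
  have "compact (closure {x. f x \<noteq> 0} \<union> closure {x. g x \<noteq> 0})"
    using assms by (intro compact_Un) (auto simp: test_functions_def)
  with sub have "compact (closure {x. ?h x \<noteq> 0})"
    by (meson bounded_subset closed_closure compact_eq_bounded_closed)
  moreover have "closure {x. ?h x \<noteq> 0} \<subseteq> \<Omega>"
    using sub assms unfolding test_functions_def by blast
  ultimately show ?thesis
    using smooth_lincomb[of f g c d] assms unfolding test_functions_def by simp
qed

lemma smooth_L2:
  fixes \<Omega> :: "'a::euclidean_space set"
  assumes "open \<Omega>" "bounded \<Omega>" "smooth f"
  shows "f \<in> L2 \<Omega>"
proof -
  have \<Omega>: "\<Omega> \<in> lmeasurable"
    using assms by (simp add: lmeasurable_open)
  interpret finite_measure "lebesgue_on \<Omega>"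
    using \<Omega> by (rule finite_measure_lebesgue_on)
  have meas: "f \<in> borel_measurable (lebesgue_on \<Omega>)"
    using smooth_imp_continuous[OF assms(3)] \<Omega>
    by (intro continuous_imp_measurable_on_sets_lebesgue) (auto simp: fmeasurableD)
  \<comment> \<open>\<open>f\<close> is smooth on the whole space, hence bounded up to the boundary
    of \<Omega>.\<close>
  have "compact (f ` closure \<Omega>)"
    using assms by (intro compact_continuous_image smooth_imp_continuous) (auto simp: compact_closure)
  then obtain B where B: "\<And>x. x \<in> closure \<Omega> \<Longrightarrow> cmod (f x) \<le> B"
    by (meson bounded_iff compact_imp_bounded image_eqI)
  have "(cmod (f x))\<^sup>2 \<le> B\<^sup>2" if "x \<in> \<Omega>" for x
    using B closure_subset that by (intro power_mono) auto
  then have "integrable (lebesgue_on \<Omega>) (\<lambda>x. (cmod (f x))\<^sup>2)"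
    using meas by (intro integrable_const_bound[of _ "B\<^sup>2"] AE_I2) (auto simp: space_restrict_space)
  with meas show ?thesis
    by (simp add: L2_def)
qed

lemma test_functions_L2:
  assumes "open \<Omega>" "bounded \<Omega>" "\<psi> \<in> test_functions \<Omega>"
  shows "\<psi> \<in> L2 \<Omega>" and "b \<in> Basis \<Longrightarrow> partial_deriv b \<psi> \<in> L2 \<Omega>"
  using assms by (auto simp: test_functions_def intro: smooth_L2 smooth_partial_deriv)

lemma H10_grad_L2:
  assumes "H10_grad \<Omega> v g"
  shows "v \<in> L2 \<Omega>" and "b \<in> Basis \<Longrightarrow> g b \<in> L2 \<Omega>"
  using assms by (auto simp: H10_grad_def)

lemma L2_norm_lincomb_tendsto_0:
  assumes "\<And>n. f n \<in> L2 \<Omega>" "\<And>n. g n \<in> L2 \<Omega>" "u \<in> L2 \<Omega>" "v \<in> L2 \<Omega>"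
    and "(\<lambda>n. L2_norm \<Omega> (\<lambda>x. f n x - u x)) \<longlonglongrightarrow> 0"
    and "(\<lambda>n. L2_norm \<Omega> (\<lambda>x. g n x - v x)) \<longlonglongrightarrow> 0"
  shows "(\<lambda>n. L2_norm \<Omega> (\<lambda>x. (c * f n x + d * g n x) - (c * u x + d * v x))) \<longlonglongrightarrow> 0"
proof (rule tendsto_sandwich[of "\<lambda>_. 0"])
  have "L2_norm \<Omega> (\<lambda>x. (c * f n x + d * g n x) - (c * u x + d * v x))
      \<le> cmod c * L2_norm \<Omega> (\<lambda>x. f n x - u x) + cmod d * L2_norm \<Omega> (\<lambda>x. g n x - v x)" for n
    using L2_norm_triangle[OF L2_scale[OF L2_diff[OF assms(1)[of n] assms(3)], of c]
        L2_scale[OF L2_diff[OF assms(2)[of n] assms(4)], of d]]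
    by (simp add: L2_norm_scale add_diff_add flip: right_diff_distrib)
  then show "\<forall>\<^sub>F n in sequentially. L2_norm \<Omega> (\<lambda>x. (c * f n x + d * g n x) - (c * u x + d * v x))
      \<le> cmod c * L2_norm \<Omega> (\<lambda>x. f n x - u x) + cmod d * L2_norm \<Omega> (\<lambda>x. g n x - v x)"
    by simp
  show "(\<lambda>n. cmod c * L2_norm \<Omega> (\<lambda>x. f n x - u x) + cmod d * L2_norm \<Omega> (\<lambda>x. g n x - v x)) \<longlonglongrightarrow> 0"
    using tendsto_add[OF tendsto_mult_right_zero[OF assms(5)] tendsto_mult_right_zero[OF assms(6)]]
    by simp
qed simp_all

lemma H10_grad_lincomb:
  assumes \<Omega>: "open \<Omega>" "bounded \<Omega>" and "H10_grad \<Omega> v g" "H10_grad \<Omega> w h"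
  shows "H10_grad \<Omega> (\<lambda>x. c * v x + d * w x) (\<lambda>b x. c * g b x + d * h b x)"
proof -
  obtain \<psi> where \<psi>: "\<And>n. \<psi> n \<in> test_functions \<Omega>"
      "(\<lambda>n. L2_norm \<Omega> (\<lambda>x. \<psi> n x - v x)) \<longlonglongrightarrow> 0"
      "\<And>b. b \<in> Basis \<Longrightarrow> (\<lambda>n. L2_norm \<Omega> (\<lambda>x. partial_deriv b (\<psi> n) x - g b x)) \<longlonglongrightarrow> 0"
    using assms(3) unfolding H10_grad_def by blast
  obtain \<eta> where \<eta>: "\<And>n. \<eta> n \<in> test_functions \<Omega>"
      "(\<lambda>n. L2_norm \<Omega> (\<lambda>x. \<eta> n x - w x)) \<longlonglongrightarrow> 0"
      "\<And>b. b \<in> Basis \<Longrightarrow> (\<lambda>n. L2_norm \<Omega> (\<lambda>x. partial_deriv b (\<eta> n) x - h b x)) \<longlonglongrightarrow> 0"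
    using assms(4) unfolding H10_grad_def by blast
  note L2 = H10_grad_L2[OF assms(3)] H10_grad_L2[OF assms(4)]
    test_functions_L2[OF \<Omega> \<psi>(1)] test_functions_L2[OF \<Omega> \<eta>(1)]
  have deriv: "partial_deriv b (\<lambda>x. c * \<psi> n x + d * \<eta> n x)
      = (\<lambda>x. c * partial_deriv b (\<psi> n) x + d * partial_deriv b (\<eta> n) x)" for n b
    using \<psi>(1)[of n] \<eta>(1)[of n]
    by (intro ext partial_deriv_lincomb smooth_imp_differentiable) (auto simp: test_functions_def)
  show ?thesis
    unfolding H10_grad_def
  proof (intro conjI ballI exI[of _ "\<lambda>n x. c * \<psi> n x + d * \<eta> n x"] allI)
    show "(\<lambda>x. c * \<psi> n x + d * \<eta> n x) \<in> test_functions \<Omega>" for n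
      by (intro test_functions_lincomb \<psi> \<eta>)
    show "(\<lambda>n. L2_norm \<Omega> (\<lambda>x. c * \<psi> n x + d * \<eta> n x - (c * v x + d * w x))) \<longlonglongrightarrow> 0"
      by (intro L2_norm_lincomb_tendsto_0 \<psi> \<eta> L2)
    show "(\<lambda>n. L2_norm \<Omega> (\<lambda>x. partial_deriv b (\<lambda>x. c * \<psi> n x + d * \<eta> n x) x
        - (c * g b x + d * h b x))) \<longlonglongrightarrow> 0" if "b \<in> Basis" for b
      unfolding deriv by (intro L2_norm_lincomb_tendsto_0 \<psi> \<eta> L2 that)
  qed (auto intro!: L2_add L2_scale L2)
qed

section \<open>Linearity, symmetry and positivity of the Dirichlet Laplacian\<close>

lemma dirichlet_laplacian_L2:
  assumes "dirichlet_laplacian \<Omega> v f"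
  shows "v \<in> L2 \<Omega>" and "f \<in> L2 \<Omega>"
  using assms by (auto simp: dirichlet_laplacian_def H10_grad_def)

lemma dirichlet_laplacian_lincomb:
  assumes \<Omega>: "open \<Omega>" "bounded \<Omega>"
    and "dirichlet_laplacian \<Omega> v f" "dirichlet_laplacian \<Omega> w e"
  shows "dirichlet_laplacian \<Omega> (\<lambda>x. c * v x + d * w x) (\<lambda>x. c * f x + d * e x)"
proof -
  obtain g where g: "H10_grad \<Omega> v g" "\<And>\<psi>. \<psi> \<in> test_functions \<Omega> \<Longrightarrow>
      (\<Sum>b\<in>Basis. L2_inner \<Omega> (g b) (partial_deriv b \<psi>)) = L2_inner \<Omega> f \<psi>"
    using assms(3) by (auto simp: dirichlet_laplacian_def)
  obtain h where h: "H10_grad \<Omega> w h" "\<And>\<psi>. \<psi> \<in> test_functions \<Omega> \<Longrightarrow>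
      (\<Sum>b\<in>Basis. L2_inner \<Omega> (h b) (partial_deriv b \<psi>)) = L2_inner \<Omega> e \<psi>"
    using assms(4) by (auto simp: dirichlet_laplacian_def)
  note L2 = H10_grad_L2[OF g(1)] H10_grad_L2[OF h(1)] dirichlet_laplacian_L2[OF assms(3)]
    dirichlet_laplacian_L2[OF assms(4)] test_functions_L2[OF \<Omega>]
  show ?thesis
    unfolding dirichlet_laplacian_def
  proof (intro conjI exI[of _ "\<lambda>b x. c * g b x + d * h b x"] ballI)
    show "H10_grad \<Omega> (\<lambda>x. c * v x + d * w x) (\<lambda>b x. c * g b x + d * h b x)"
      by (rule H10_grad_lincomb[OF \<Omega> g(1) h(1)])
    fix \<psi> assume \<psi>: "\<psi> \<in> test_functions \<Omega>"
    have "(\<Sum>b\<in>Basis. L2_inner \<Omega> (\<lambda>x. c * g b x + d * h b x) (partial_deriv b \<psi>))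
        = (\<Sum>b\<in>Basis. c * L2_inner \<Omega> (g b) (partial_deriv b \<psi>)
              + d * L2_inner \<Omega> (h b) (partial_deriv b \<psi>))"
      using \<psi> by (intro sum.cong refl) (simp add: L2_inner_add_left L2_inner_scale_left L2_scale L2)
    also have "\<dots> = L2_inner \<Omega> (\<lambda>x. c * f x + d * e x) \<psi>"
      using \<psi> by (simp add: sum.distrib g h L2_inner_add_left L2_inner_scale_left L2_scale L2
          flip: sum_distrib_left)
    finally show "(\<Sum>b\<in>Basis. L2_inner \<Omega> (\<lambda>x. c * g b x + d * h b x) (partial_deriv b \<psi>))
        = L2_inner \<Omega> (\<lambda>x. c * f x + d * e x) \<psi>" .
  qed (intro L2_add L2_scale L2(5,6) L2)
qed

text \<open>Both sides are continuous along a sequence of test functions that approximates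
  \<open>w\<close> together with its gradient. This is what permits testing an equation with its own
  solution.\<close>

lemma weak_form_H10:
  assumes \<Omega>: "open \<Omega>" "bounded \<Omega>" and f: "f \<in> L2 \<Omega>"
    and g: "\<And>b. b \<in> Basis \<Longrightarrow> g b \<in> L2 \<Omega>"
    and weak: "\<And>\<psi>. \<psi> \<in> test_functions \<Omega> \<Longrightarrow>
      (\<Sum>b\<in>Basis. L2_inner \<Omega> (g b) (partial_deriv b \<psi>)) = L2_inner \<Omega> f \<psi>"
    and h: "H10_grad \<Omega> w h"
  shows "(\<Sum>b\<in>Basis. L2_inner \<Omega> (g b) (h b)) = L2_inner \<Omega> f w"
proof -
  obtain \<psi> where \<psi>: "\<And>n. \<psi> n \<in> test_functions \<Omega>"
      "(\<lambda>n. L2_norm \<Omega> (\<lambda>x. \<psi> n x - w x)) \<longlonglongrightarrow> 0"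
      "\<And>b. b \<in> Basis \<Longrightarrow> (\<lambda>n. L2_norm \<Omega> (\<lambda>x. partial_deriv b (\<psi> n) x - h b x)) \<longlonglongrightarrow> 0"
    using h unfolding H10_grad_def by blast
  note L2 = H10_grad_L2[OF h] test_functions_L2[OF \<Omega> \<psi>(1)]
  have "(\<lambda>n. L2_inner \<Omega> f (\<psi> n)) \<longlonglongrightarrow> L2_inner \<Omega> f w"
    by (intro tendsto_L2_inner_right f \<psi> L2)
  moreover have "(\<lambda>n. \<Sum>b\<in>Basis. L2_inner \<Omega> (g b) (partial_deriv b (\<psi> n)))
      \<longlonglongrightarrow> (\<Sum>b\<in>Basis. L2_inner \<Omega> (g b) (h b))"
    by (intro tendsto_sum tendsto_L2_inner_right g \<psi> L2)
  ultimately show ?thesis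
    using weak[OF \<psi>(1)] by (auto intro: LIMSEQ_unique)
qed

text \<open>Each equation is tested with the other function; the two sums of gradient pairings are
  complex conjugates.\<close>

lemma dirichlet_laplacian_symmetric:
  assumes \<Omega>: "open \<Omega>" "bounded \<Omega>"
    and "dirichlet_laplacian \<Omega> v f" "dirichlet_laplacian \<Omega> w e"
  shows "L2_inner \<Omega> f w = L2_inner \<Omega> v e"
proof -
  obtain g where g: "H10_grad \<Omega> v g" "\<And>\<psi>. \<psi> \<in> test_functions \<Omega> \<Longrightarrow>
      (\<Sum>b\<in>Basis. L2_inner \<Omega> (g b) (partial_deriv b \<psi>)) = L2_inner \<Omega> f \<psi>"
    using assms(3) by (auto simp: dirichlet_laplacian_def)
  obtain h where h: "H10_grad \<Omega> w h" "\<And>\<psi>. \<psi> \<in> test_functions \<Omega> \<Longrightarrow>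
      (\<Sum>b\<in>Basis. L2_inner \<Omega> (h b) (partial_deriv b \<psi>)) = L2_inner \<Omega> e \<psi>"
    using assms(4) by (auto simp: dirichlet_laplacian_def)
  have "L2_inner \<Omega> f w = (\<Sum>b\<in>Basis. L2_inner \<Omega> (g b) (h b))"
    using weak_form_H10[OF \<Omega> dirichlet_laplacian_L2(2)[OF assms(3)] H10_grad_L2(2)[OF g(1)] g(2) h(1)]
    by simp
  moreover have "L2_inner \<Omega> e v = (\<Sum>b\<in>Basis. L2_inner \<Omega> (h b) (g b))"
    using weak_form_H10[OF \<Omega> dirichlet_laplacian_L2(2)[OF assms(4)] H10_grad_L2(2)[OF h(1)] h(2) g(1)]
    by simp
  ultimately have "L2_inner \<Omega> f w = cnj (L2_inner \<Omega> e v)"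
    by (simp add: cnj_L2_inner)
  then show ?thesis
    by (simp add: cnj_L2_inner)
qed

text \<open>Testing with \<open>v\<close> itself turns the pairing into the Dirichlet energy of
  \<open>v\<close>.\<close>

lemma dirichlet_laplacian_nonneg:
  assumes \<Omega>: "open \<Omega>" "bounded \<Omega>" and "dirichlet_laplacian \<Omega> v f"
  shows "0 \<le> Re (L2_inner \<Omega> f v)"
proof -
  obtain g where g: "H10_grad \<Omega> v g" "\<And>\<psi>. \<psi> \<in> test_functions \<Omega> \<Longrightarrow>
      (\<Sum>b\<in>Basis. L2_inner \<Omega> (g b) (partial_deriv b \<psi>)) = L2_inner \<Omega> f \<psi>"
    using assms(3) by (auto simp: dirichlet_laplacian_def)
  have "L2_inner \<Omega> f v = (\<Sum>b\<in>Basis. L2_inner \<Omega> (g b) (g b))"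
    using weak_form_H10[OF \<Omega> dirichlet_laplacian_L2(2)[OF assms(3)] H10_grad_L2(2)[OF g(1)] g(2) g(1)]
    by simp
  also have "\<dots> = of_real (\<Sum>b\<in>Basis. (L2_norm \<Omega> (g b))\<^sup>2)"
    by (simp add: L2_inner_self)
  finally show ?thesis
    by (simp add: sum_nonneg)
qed

lemma dirichlet_laplacian_energy_estimate:
  assumes \<Omega>: "open \<Omega>" "bounded \<Omega>" and dl: "dirichlet_laplacian \<Omega> w f" and F: "F \<in> L2 \<Omega>"
    and eq: "\<And>x. x \<in> \<Omega> \<Longrightarrow> f x = F x - B x * w x"
    and c: "0 < c" "\<And>x. x \<in> \<Omega> \<Longrightarrow> c \<le> Re (B x)"
  shows "L2_norm \<Omega> w \<le> L2_norm \<Omega> F / c"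
proof -
  note L2 = dirichlet_laplacian_L2[OF dl]
  have int: "integrable (lebesgue_on \<Omega>) (\<lambda>x. (F x - f x) * cnj (w x))"
    by (intro integrable_L2_inner L2_diff F L2)
  have "c * (L2_norm \<Omega> w)\<^sup>2 = (LINT x|lebesgue_on \<Omega>. c * (cmod (w x))\<^sup>2)"
    by (simp add: L2_norm_square)
  also have "\<dots> \<le> (LINT x|lebesgue_on \<Omega>. Re ((F x - f x) * cnj (w x)))"
  proof (rule integral_mono)
    show "integrable (lebesgue_on \<Omega>) (\<lambda>x. c * (cmod (w x))\<^sup>2)"
      using L2_square_integrable[OF L2(1)] by simp
    show "integrable (lebesgue_on \<Omega>) (\<lambda>x. Re ((F x - f x) * cnj (w x)))"
      using int by (rule integrable_Re)
    fix x assume "x \<in> space (lebesgue_on \<Omega>)"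
    then have x: "x \<in> \<Omega>" by (simp add: space_restrict_space)
    have "(F x - f x) * cnj (w x) = B x * of_real ((cmod (w x))\<^sup>2)"
      unfolding complex_norm_square by (simp add: eq[OF x])
    then have "Re ((F x - f x) * cnj (w x)) = Re (B x) * (cmod (w x))\<^sup>2"
      by (simp del: of_real_power)
    then show "c * (cmod (w x))\<^sup>2 \<le> Re ((F x - f x) * cnj (w x))"
      using c(2)[OF x] by (simp add: mult_right_mono)
  qed
  also have "\<dots> = Re (L2_inner \<Omega> (\<lambda>x. F x - f x) w)"
    unfolding L2_inner_def by (rule integral_Re[OF int])
  also have "\<dots> = Re (L2_inner \<Omega> F w) - Re (L2_inner \<Omega> f w)"
    by (simp add: L2_inner_diff_left F L2)
  also have "\<dots> \<le> Re (L2_inner \<Omega> F w)"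
    using dirichlet_laplacian_nonneg[OF \<Omega> dl] by simp
  also have "\<dots> \<le> L2_norm \<Omega> F * L2_norm \<Omega> w"
    using L2_Cauchy_Schwarz[OF F L2(1)] complex_Re_le_cmod order_trans by blast
  finally have "c * L2_norm \<Omega> w * L2_norm \<Omega> w \<le> L2_norm \<Omega> F * L2_norm \<Omega> w"
    by (simp add: power2_eq_square mult.assoc)
  then have "c * L2_norm \<Omega> w \<le> L2_norm \<Omega> F"
    using L2_norm_nonneg[of \<Omega> w] L2_norm_nonneg[of \<Omega> F]
    by (cases "L2_norm \<Omega> w = 0") (auto simp: mult_le_cancel_right)
  then show ?thesis
    using c(1) by (simp add: field_simps)
qed

subsection \<open>Integrals along \<open>\<Gamma>\<^bsub>\<theta>,\<kappa>\<^esub>\<close>\<close>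

text \<open>Completeness of the complex numbers supplies the derivative, so no candidate for it has
  to be named. The derivative is taken within \<open>S\<close> because the contour lies on the
  boundary of the closed sector.\<close>

lemma field_differentiable_if_quotients_Cauchy:
  fixes f :: "complex \<Rightarrow> complex"
  assumes "0 < d" and quot: "\<And>x y. \<lbrakk>x \<in> S - {z}; y \<in> S - {z}; dist x z < d; dist y z < d\<rbrakk> \<Longrightarrow>
      dist ((f x - f z) / (x - z)) ((f y - f z) / (y - z)) \<le> C * (dist x z + dist y z)"
  shows "f field_differentiable (at z within S)"
proof (cases "z islimpt S")
  case False
  \<comment> \<open>At a point that \<open>S\<close> does not accumulate at, the filter is trivial
    and every number is a derivative.\<close>
  then have "(f has_field_derivative 0) (at z within S)"
    by (simp add: has_field_derivative_iff trivial_limit_within[symmetric])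
  then show ?thesis
    by (auto simp: field_differentiable_def)
next
  case True
  define q where "q x = (f x - f z) / (x - z)" for x
  obtain X where X: "\<And>n::nat. X n \<in> S - {z}" "X \<longlonglongrightarrow> z"
    using True by (auto simp: islimpt_sequential)
  have dX: "(\<lambda>n. dist (X n) z) \<longlonglongrightarrow> 0"
    using X(2) by (rule tendsto_dist_iff[THEN iffD1])
  have evX: "\<forall>\<^sub>F n in sequentially. dist (X n) z < d"
    using order_tendstoD(2)[OF dX \<open>0 < d\<close>] .
  have "Cauchy (\<lambda>n. q (X n))"
  proof (rule metric_CauchyI)
    fix e :: real assume "0 < e"
    have "(\<lambda>n. C * dist (X n) z) \<longlonglongrightarrow> 0"
      using tendsto_mult_right_zero[OF dX] .
    then have "\<forall>\<^sub>F n in sequentially. C * dist (X n) z < e / 2"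
      using \<open>0 < e\<close> by (intro order_tendstoD(2)) auto
    with evX obtain N where N: "\<And>n. N \<le> n \<Longrightarrow> dist (X n) z < d \<and> C * dist (X n) z < e / 2"
      using eventually_conj unfolding eventually_sequentially by (metis (mono_tags, lifting) nle_le order_trans)
    have "dist (q (X m)) (q (X n)) < e" if "N \<le> m" "N \<le> n" for m n
    proof -
      have "dist (q (X m)) (q (X n)) \<le> C * (dist (X m) z + dist (X n) z)"
        unfolding q_def using N[OF that(1)] N[OF that(2)] by (intro quot X) auto
      then show ?thesis
        using N[OF that(1)] N[OF that(2)] by (simp add: distrib_left)
    qed
    then show "\<exists>M. \<forall>m\<ge>M. \<forall>n\<ge>M. dist (q (X m)) (q (X n)) < e"
      by blast
  qed
  then obtain L where L: "(\<lambda>n. q (X n)) \<longlonglongrightarrow> L"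
    using Cauchy_convergent_iff convergent_def by blast
  \<comment> \<open>Let the second point in \<open>quot\<close> tend to \<open>z\<close> along
    \<open>X\<close>.\<close>
  have bound: "dist (q x) L \<le> C * dist x z" if x: "x \<in> S - {z}" "dist x z < d" for x
  proof (rule tendsto_le[OF sequentially_bot])
    show "(\<lambda>n. C * (dist x z + dist (X n) z)) \<longlonglongrightarrow> C * dist x z"
      using tendsto_mult_left[OF tendsto_add[OF tendsto_const dX], of C "dist x z"] by simp
    show "(\<lambda>n. dist (q x) (q (X n))) \<longlonglongrightarrow> dist (q x) L"
      by (intro tendsto_intros L)
    show "\<forall>\<^sub>F n in sequentially. dist (q x) (q (X n)) \<le> C * (dist x z + dist (X n) z)"
      using evX unfolding q_def by eventually_elim (intro quot X x)
  qed
  have "(q \<longlongrightarrow> L) (at z within S)"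
  proof (rule Lim_null[THEN iffD2], rule Lim_null_comparison)
    have "((\<lambda>x. C * dist x z) \<longlongrightarrow> C * dist z z) (at z within S)"
      by (intro tendsto_intros)
    then show "((\<lambda>x. C * dist x z) \<longlongrightarrow> 0) (at z within S)"
      by simp
    show "\<forall>\<^sub>F x in at z within S. norm (q x - L) \<le> C * dist x z"
      unfolding eventually_at using bound \<open>0 < d\<close> by (auto simp: dist_norm intro!: exI[of _ d])
  qed
  then have "(f has_field_derivative L) (at z within S)"
    unfolding has_field_derivative_iff q_def[abs_def] .
  then show ?thesis
    by (auto simp: field_differentiable_def)
qed

text \<open>In the coordinate \<open>\<zeta> = Ln z\<close> the sector is a convex half strip, on which holomorphic
  functions have primitives. This is where the contour is moved.\<close>

lemma hankel_integral_change_radius: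
  assumes \<kappa>: "0 < \<kappa>" "\<kappa> \<le> R" and \<theta>: "0 < \<theta>" "\<theta> < pi"
    and holo: "f holomorphic_on sector \<theta> \<kappa>" and int: "hankel_integrable \<theta> \<kappa> f"
  shows "hankel_integral \<theta> \<kappa> f = hankel_integral \<theta> R f" and "hankel_integrable \<theta> R f"
proof -
  define S where "S = {\<zeta>. ln \<kappa> \<le> Re \<zeta>} \<inter> ({\<zeta>. - \<theta> \<le> Im \<zeta>} \<inter> {\<zeta>. Im \<zeta> \<le> \<theta>})"
  \<comment> \<open>The integrand pulled back by exp: the second factor is the Jacobian.\<close>
  define F where "F \<zeta> = f (exp \<zeta>) * exp \<zeta>" for \<zeta>
  have "exp \<zeta> \<in> sector \<theta> \<kappa>" if "\<zeta> \<in> S" for \<zeta>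
    using that \<theta> \<kappa> ln_ge_iff[of \<kappa> "exp (Re \<zeta>)"]
    by (auto simp: sector_def S_def Arg_exp simp flip: ln_le_cancel_iff)
  then have "F holomorphic_on S"
    unfolding F_def using holomorphic_on_compose_gen[OF holomorphic_on_exp holo, of S]
    by (auto intro!: holomorphic_intros simp: o_def)
  \<comment> \<open>The contour runs along the boundary of the sector, so the primitive must be
    valid up to the boundary of \<open>S\<close>. Continuity on \<open>S\<close> and
    differentiability in its interior suffice for that; the exceptional set is empty.\<close>
  then have "\<And>x. x \<in> interior S - {} \<Longrightarrow> F field_differentiable at x" "continuous_on S F"
    by (auto simp: holomorphic_on_imp_continuous_on holomorphic_on_def)
       (metis at_within_interior interior_subset subsetD)
  moreover have "convex S"
    unfolding S_def
    by (intro convex_Int convex_halfspace_Re_ge convex_halfspace_Im_ge convex_halfspace_Im_le)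
  ultimately obtain P where P: "\<And>\<zeta>. \<zeta> \<in> S \<Longrightarrow> (P has_field_derivative F \<zeta>) (at \<zeta> within S)"
    using holomorphic_convex_primitive[of S "{}" F, OF _ finite.emptyI] by metis
  have FTC: "((\<lambda>x. \<gamma>' x * F (\<gamma> x)) has_integral (P (\<gamma> b) - P (\<gamma> a))) {a..b}"
    if "a \<le> b" "\<And>x. x \<in> {a..b} \<Longrightarrow> (\<gamma> has_vector_derivative \<gamma>' x) (at x within {a..b})"
      "\<And>x. x \<in> {a..b} \<Longrightarrow> \<gamma> x \<in> S" for a b :: real and \<gamma> \<gamma>'
  proof -
    have "((P \<circ> \<gamma>) has_vector_derivative \<gamma>' x * F (\<gamma> x)) (at x within {a..b})" if "x \<in> {a..b}" for x
    proof (rule field_vector_diff_chain_within)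
      show "(P has_field_derivative F (\<gamma> x)) (at (\<gamma> x) within \<gamma> ` {a..b})"
        using that \<open>\<And>x. x \<in> {a..b} \<Longrightarrow> \<gamma> x \<in> S\<close>
        by (intro DERIV_subset[OF P]) auto
    qed (rule \<open>\<And>x. x \<in> {a..b} \<Longrightarrow> (\<gamma> has_vector_derivative \<gamma>' x) (at x within {a..b})\<close>[OF that])
    from fundamental_theorem_of_calculus[OF \<open>a \<le> b\<close> this] show ?thesis
      by simp
  qed
  \<comment> \<open>In the logarithmic coordinate an arc of radius \<open>r\<close> is the vertical
    segment with real part \<open>ln r\<close>, and a ray of argument \<open>\<phi>\<close> is a
    horizontal half-line. Thus both reduce to differences of \<open>P\<close> at corners of the
    strip.\<close>
  have arc: "(f has_contour_integral (P (Complex (ln r) \<theta>) - P (Complex (ln r) (- \<theta>))))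
      (part_circlepath 0 r (- \<theta>) \<theta>)" if "\<kappa> \<le> r" for r
  proof -
    have r: "0 < r" "ln \<kappa> \<le> ln r" using that \<kappa> by auto
    have "((\<lambda>s. \<i> * F (Complex (ln r) s)) has_integral
        (P (Complex (ln r) \<theta>) - P (Complex (ln r) (- \<theta>)))) {- \<theta>..\<theta>}"
    proof (rule FTC)
      show "(Complex (ln r) has_vector_derivative \<i>) (at s within {- \<theta>..\<theta>})" for s
        unfolding Complex_eq
        by (auto intro!: derivative_eq_intros simp: has_vector_derivative_complex_iff)
    qed (use \<theta> r in \<open>auto simp: S_def\<close>)
    moreover have "\<i> * F (Complex (ln r) s) = f (0 + r * cis s) * r * \<i> * cis s" for s
      using r by (simp add: F_def Complex_eq exp_add exp_of_real cis_conv_exp mult_ac)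
    ultimately show ?thesis
      using \<theta> by (subst has_contour_integral_part_circlepath_iff) auto
  qed
  have ray: "set_integrable lborel {R..} (\<lambda>r. f (rcis r \<phi>) * cis \<phi>)"
    "(LINT r:{\<kappa>..}|lborel. f (rcis r \<phi>) * cis \<phi>)
       = P (Complex (ln R) \<phi>) - P (Complex (ln \<kappa>) \<phi>) + (LINT r:{R..}|lborel. f (rcis r \<phi>) * cis \<phi>)"
    if \<phi>: "- \<theta> \<le> \<phi>" "\<phi> \<le> \<theta>" and int\<phi>: "set_integrable lborel {\<kappa>..} (\<lambda>r. f (rcis r \<phi>) * cis \<phi>)" for \<phi>
  proof -
    show intR: "set_integrable lborel {R..} (\<lambda>r. f (rcis r \<phi>) * cis \<phi>)"
      by (rule set_integrable_subset[OF int\<phi>]) (use \<kappa> in auto)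
    have "((\<lambda>r. of_real (1 / r) * F (Complex (ln r) \<phi>)) has_integral
        (P (Complex (ln R) \<phi>) - P (Complex (ln \<kappa>) \<phi>))) {\<kappa>..R}"
    proof (rule FTC)
      show "((\<lambda>r. Complex (ln r) \<phi>) has_vector_derivative of_real (1 / r)) (at r within {\<kappa>..R})"
        if "r \<in> {\<kappa>..R}" for r
        using that \<kappa> unfolding has_vector_derivative_complex_iff
        by (auto intro!: derivative_eq_intros simp: has_vector_derivative_complex_iff)
    qed (use \<phi> \<kappa> in \<open>auto simp: S_def\<close>)
    moreover have "of_real (1 / r) * F (Complex (ln r) \<phi>) = f (rcis r \<phi>) * cis \<phi>"
      if "r \<in> {\<kappa>..R}" for r
      using that \<kappa> by (simp add: F_def Complex_eq exp_add exp_of_real cis_conv_exp rcis_def)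
    ultimately have seg: "((\<lambda>r. f (rcis r \<phi>) * cis \<phi>) has_integral
        (P (Complex (ln R) \<phi>) - P (Complex (ln \<kappa>) \<phi>))) {\<kappa>..R}"
      using has_integral_cong by (metis (no_types, lifting))
    have "((\<lambda>r. f (rcis r \<phi>) * cis \<phi>) has_integral
        (P (Complex (ln R) \<phi>) - P (Complex (ln \<kappa>) \<phi>)
           + integral {R..} (\<lambda>r. f (rcis r \<phi>) * cis \<phi>))) ({\<kappa>..R} \<union> {R..})"
    proof (rule has_integral_Un[OF seg])
      show "((\<lambda>r. f (rcis r \<phi>) * cis \<phi>) has_integral integral {R..} (\<lambda>r. f (rcis r \<phi>) * cis \<phi>)) {R..}"
        by (intro integrable_integral set_borel_integral_eq_integral(1) intR)
      have "{\<kappa>..R} \<inter> {R..} = {R}" using \<kappa> by auto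
      then show "negligible ({\<kappa>..R} \<inter> {R..})" by simp
    qed
    moreover have "{\<kappa>..R} \<union> {R..} = {\<kappa>..}" using \<kappa> by auto
    ultimately show "(LINT r:{\<kappa>..}|lborel. f (rcis r \<phi>) * cis \<phi>)
       = P (Complex (ln R) \<phi>) - P (Complex (ln \<kappa>) \<phi>) + (LINT r:{R..}|lborel. f (rcis r \<phi>) * cis \<phi>)"
      unfolding set_borel_integral_eq_integral(2)[OF int\<phi>] set_borel_integral_eq_integral(2)[OF intR]
      by (intro integral_unique) (simp only:)
  qed
  note int' = int[unfolded hankel_integrable_def]
  note up = ray[of \<theta>, OF _ _ int'[THEN conjunct1]]
  note down = ray[of "- \<theta>", OF _ _ int'[THEN conjunct2, THEN conjunct1]]
  show "hankel_integrable \<theta> R f"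
    unfolding hankel_integrable_def
    using up(1) down(1) arc[OF \<kappa>(2)] \<theta> by (auto simp: contour_integrable_on_def)
  show "hankel_integral \<theta> \<kappa> f = hankel_integral \<theta> R f"
  proof -
    have \<theta>': "- \<theta> \<le> \<theta>" using \<theta> by simp
    show ?thesis
      \<comment> \<open>The values of \<open>P\<close> at the two corners of radius
        \<open>\<kappa>\<close> cancel, and those at radius \<open>R\<close> form the new arc. Only
        bounded pieces have moved, so no decay at infinity is involved.\<close>
      unfolding hankel_integral_def contour_integral_unique[OF arc[OF order_refl]]
        contour_integral_unique[OF arc[OF \<kappa>(2)]] up(2)[OF \<theta>' order_refl] down(2)[OF order_refl \<theta>']
      by (simp only: algebra_simps)
  qed
qed

text \<open>On the arc, of length \<open>2 * \<theta> * R\<close>, the exponential is at most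
  \<open>exp (t * R)\<close>. On each ray its modulus is \<open>exp (t * r * cos \<theta>)\<close>
  with a negative cosine, which integrates to at most
  \<open>1 / (t * \<bar>cos \<theta>\<bar>)\<close>.\<close>

lemma hankel_integral_bound:
  assumes \<theta>: "pi / 2 < \<theta>" "\<theta> < pi" and "0 < R" "0 < t" "0 \<le> M"
    and int: "hankel_integrable \<theta> R f"
    and le: "\<And>z. z \<in> sector \<theta> R \<Longrightarrow> cmod (f z) \<le> M * exp (t * Re z)"
  shows "cmod (hankel_integral \<theta> R f) \<le> M * (2 * \<theta> * R * exp (t * R) + 2 / (t * \<bar>cos \<theta>\<bar>))"
proof -
  have cos: "cos \<theta> < 0"
    using cos_monotone_0_pi[of "pi / 2" \<theta>] \<theta> by simp
  have ray: "cmod (LINT r:{R..}|lborel. f (rcis r \<phi>) * cis \<phi>) \<le> M * (1 / (t * \<bar>cos \<theta>\<bar>))"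
    if int\<phi>: "set_integrable lborel {R..} (\<lambda>r. f (rcis r \<phi>) * cis \<phi>)" and \<phi>: "\<phi> = \<theta> \<or> \<phi> = - \<theta>" for \<phi>
  proof -
    have pos: "0 < - t * cos \<theta>"
      using cos \<open>0 < t\<close> by (simp add: mult_pos_neg)
    note exp_int = has_integral_mult_right[OF has_integral_exp_minus_to_infinity[OF pos, of R], of M]
    have "cmod (LINT r:{R..}|lborel. f (rcis r \<phi>) * cis \<phi>)
        \<le> integral {R..} (\<lambda>r. M * exp (- (- t * cos \<theta>) * r))"
      unfolding set_borel_integral_eq_integral(2)[OF int\<phi>]
    proof (rule Henstock_Kurzweil_Integration.integral_norm_bound_integral)
      show "(\<lambda>r. f (rcis r \<phi>) * cis \<phi>) integrable_on {R..}"
        by (rule set_borel_integral_eq_integral(1)[OF int\<phi>])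
      show "(\<lambda>r. M * exp (- (- t * cos \<theta>) * r)) integrable_on {R..}"
        using exp_int by (rule has_integral_integrable)
      fix r assume "r \<in> {R..}"
      then have r: "rcis r \<phi> \<in> sector \<theta> R" "Re (rcis r \<phi>) = r * cos \<theta>"
        using \<phi> \<theta> \<open>0 < R\<close> by (auto simp: sector_def Arg_rcis)
      from le[OF r(1)] show "norm (f (rcis r \<phi>) * cis \<phi>) \<le> M * exp (- (- t * cos \<theta>) * r)"
        unfolding r(2) by (simp add: norm_mult mult_ac)
    qed
    also have "\<dots> = M * (exp (- (- t * cos \<theta>) * R) / (- t * cos \<theta>))"
      by (rule integral_unique[OF exp_int])
    also have "\<dots> \<le> M * (1 / (- t * cos \<theta>))"
      using pos \<open>0 < R\<close> \<open>0 \<le> M\<close>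
      by (intro mult_left_mono divide_right_mono) (auto simp: mult_nonpos_nonneg)
    also have "- t * cos \<theta> = t * \<bar>cos \<theta>\<bar>"
      using cos by simp
    finally show ?thesis .
  qed
  have "cmod (contour_integral (part_circlepath 0 R (- \<theta>) \<theta>) f)
      \<le> M * exp (t * R) * R * (\<theta> - - \<theta>)"
  proof (rule has_contour_integral_bound_part_circlepath)
    show "(f has_contour_integral contour_integral (part_circlepath 0 R (- \<theta>) \<theta>) f)
        (part_circlepath 0 R (- \<theta>) \<theta>)"
      using int by (simp add: hankel_integrable_def has_contour_integral_integral)
    fix z assume "z \<in> path_image (part_circlepath 0 R (- \<theta>) \<theta>)"
    then obtain s where s: "- \<theta> \<le> s" "s \<le> \<theta>" and z: "z = rcis R s"
      using \<theta> by (auto simp: path_image_part_circlepath' closed_segment_eq_real_ivl rcis_def)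
    then have "z \<in> sector \<theta> R"
      using \<theta> \<open>0 < R\<close> by (auto simp: sector_def Arg_rcis)
    note le[OF this]
    also have "M * exp (t * Re z) \<le> M * exp (t * R)"
      using \<open>0 \<le> M\<close> \<open>0 < t\<close> \<open>0 < R\<close> complex_Re_le_cmod[of z] by (intro mult_left_mono) (auto simp: z)
    finally show "cmod (f z) \<le> M * exp (t * R)" .
  qed (use \<theta> \<open>0 < R\<close> \<open>0 \<le> M\<close> in auto)
  moreover have "cmod (hankel_integral \<theta> R f)
      \<le> cmod (contour_integral (part_circlepath 0 R (- \<theta>) \<theta>) f)
         + cmod (LINT r:{R..}|lborel. f (rcis r \<theta>) * cis \<theta>)
         + cmod (LINT r:{R..}|lborel. f (rcis r (- \<theta>)) * cis (- \<theta>))"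
    unfolding hankel_integral_def by norm
  moreover have "cmod (LINT r:{R..}|lborel. f (rcis r \<theta>) * cis \<theta>) \<le> M * (1 / (t * \<bar>cos \<theta>\<bar>))"
    "cmod (LINT r:{R..}|lborel. f (rcis r (- \<theta>)) * cis (- \<theta>)) \<le> M * (1 / (t * \<bar>cos \<theta>\<bar>))"
    using int unfolding hankel_integrable_def by (blast intro: ray)+
  moreover have "M * exp (t * R) * R * (\<theta> - - \<theta>) + M * (1 / (t * \<bar>cos \<theta>\<bar>)) + M * (1 / (t * \<bar>cos \<theta>\<bar>))
      = M * (2 * \<theta> * R * exp (t * R) + 2 / (t * \<bar>cos \<theta>\<bar>))"
    by (simp add: algebra_simps)
  ultimately show ?thesis
    by linarith
qed

text \<open>The integral over the contour of radius \<open>max \<kappa> (1 / t)\<close> has the right order in \<open>t\<close>; over the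
  original contour there would be a logarithm of \<open>t\<close> for \<open>p = - 1\<close>.\<close>

lemma hankel_integral_decay:
  assumes \<theta>: "pi / 2 < \<theta>" "\<theta> < pi" and "0 < \<kappa>" and t: "0 < t" "t \<le> T"
    and p: "p \<le> 0" and "0 \<le> M"
    and holo: "h holomorphic_on sector \<theta> \<kappa>"
    and int: "hankel_integrable \<theta> \<kappa> (\<lambda>z. exp (z * of_real t) * h z)"
    and le: "\<And>z. z \<in> sector \<theta> \<kappa> \<Longrightarrow> cmod (h z) \<le> M * cmod z powr p"
  shows "cmod (hankel_integral \<theta> \<kappa> (\<lambda>z. exp (z * of_real t) * h z))
    \<le> M * (2 * \<theta> * max 1 (\<kappa> * T) * exp (max 1 (\<kappa> * T)) + 2 / \<bar>cos \<theta>\<bar>) * t powr (- p - 1)"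
proof -
  define R where "R = max \<kappa> (1 / t)"
  \<comment> \<open>A bound for \<open>t * R\<close> that is uniform for t up to \<open>T\<close>;
    this is how \<open>T\<close> enters the constant.\<close>
  define L where "L = max 1 (\<kappa> * T)"
  have R: "0 < R" "\<kappa> \<le> R" "1 / t \<le> R" "t * R \<le> L"
  proof -
    have "\<kappa> * t \<le> \<kappa> * T" using \<open>0 < \<kappa>\<close> t by simp
    then show "t * R \<le> L" using t by (auto simp: R_def L_def max_def mult.commute)
  qed (use \<open>0 < \<kappa>\<close> in \<open>auto simp: R_def\<close>)
  have "0 < \<theta>" using \<theta> pi_gt_zero by linarith
  have cos: "cos \<theta> < 0"
    using cos_monotone_0_pi[of "pi / 2" \<theta>] \<theta> by simp
  have "(\<lambda>z. exp (z * of_real t) * h z) holomorphic_on sector \<theta> \<kappa>"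
    by (intro holomorphic_intros holo)
  note change = hankel_integral_change_radius[OF \<open>0 < \<kappa>\<close> R(2) \<open>0 < \<theta>\<close> \<theta>(2) this int]
  have "cmod (hankel_integral \<theta> \<kappa> (\<lambda>z. exp (z * of_real t) * h z))
      \<le> (M * R powr p) * (2 * \<theta> * R * exp (t * R) + 2 / (t * \<bar>cos \<theta>\<bar>))"
    unfolding change(1)
  proof (rule hankel_integral_bound[OF \<theta> R(1) t(1) _ change(2)])
    fix z assume "z \<in> sector \<theta> R"
    then have "R \<le> cmod z" "z \<in> sector \<theta> \<kappa>"
      using R(2) by (auto simp: sector_def)
    then have "cmod (h z) \<le> M * R powr p"
      using le[of z] R(1) p \<open>0 \<le> M\<close> by (meson mult_left_mono order_trans powr_mono2')
    then show "cmod (exp (z * of_real t) * h z) \<le> M * R powr p * exp (t * Re z)"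
      by (simp add: norm_mult mult.commute)
  qed (use \<open>0 \<le> M\<close> in simp)
  \<comment> \<open>The power has a nonpositive exponent and needs \<open>R\<close> bounded below by
    \<open>1 / t\<close>; the arc length needs \<open>R\<close> bounded above by
    \<open>L / t\<close>.\<close>
  also have "\<dots> \<le> (M * (1 / t) powr p) * (2 * \<theta> * (L / t) * exp L + 2 / (t * \<bar>cos \<theta>\<bar>))"
  proof (intro mult_mono add_mono mult_left_mono order_refl)
    show "R powr p \<le> (1 / t) powr p"
      using R(3) t(1) p by (intro powr_mono2') auto
    show "R \<le> L / t" "exp (t * R) \<le> exp L"
      using R(4) t(1) by (auto simp: field_simps)
  qed (use \<open>0 \<le> M\<close> \<open>0 < \<theta>\<close> R(1) t(1) in \<open>auto simp: L_def\<close>)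
  also have "\<dots> = M * (2 * \<theta> * L * exp L + 2 / \<bar>cos \<theta>\<bar>) * ((1 / t) powr p / t)"
    using t(1) cos by (simp add: field_simps)
  also have "(1 / t) powr p / t = t powr (- p - 1)"
    using t(1) by (simp add: powr_diff powr_minus powr_divide field_simps)
  finally show ?thesis
    unfolding L_def .
qed

subsection \<open>The resolvent\<close>

lemma norm_powr_of_real: "cmod (b powr of_real p) = cmod b powr p"
  by (simp add: norm_powr_real_powr')

text \<open>Second-order Taylor expansion: on the unit ball around \<open>b\<close>, which avoids
  both the branch cut and the open unit disc, the second derivative
  \<open>p * (p - 1) * v powr (p - 2)\<close> has modulus at most 2. The constant does not depend on
  \<open>b\<close>, hence later not on x.\<close>

lemma powr_Taylor_bound:
  assumes p: "\<bar>p\<bar> \<le> 1" and h: "cmod h \<le> 1"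
    and b: "\<And>k. cmod k \<le> 1 \<Longrightarrow> b + k \<notin> \<real>\<^sub>\<le>\<^sub>0 \<and> 1 \<le> cmod (b + k)"
  shows "cmod ((b + h) powr of_real p - b powr of_real p
           - h * (of_real p * b powr of_real (p - 1))) \<le> 2 * (cmod h)\<^sup>2"
proof -
  define f :: "nat \<Rightarrow> complex \<Rightarrow> complex" where
    "f i v = (if i = 0 then v powr of_real p
              else if i = 1 then of_real p * v powr of_real (p - 1)
              else of_real (p * (p - 1)) * v powr of_real (p - 2))" for i v
  have ball: "v \<notin> \<real>\<^sub>\<le>\<^sub>0" "1 \<le> cmod v" if "v \<in> cball b 1" for v
    using b[of "v - b"] that by (auto simp: dist_norm norm_minus_commute)
  have "cmod (f 0 (b + h) - (\<Sum>i\<le>1. f i b * (b + h - b) ^ i / fact i))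
      \<le> 2 * cmod (b + h - b) ^ Suc 1 / fact 1"
  proof (rule complex_Taylor)
    fix i v assume v: "v \<in> cball b 1" and "i \<le> (1 :: nat)"
    have deriv: "((\<lambda>v. v powr of_real r) has_field_derivative of_real r * v powr of_real (r - 1))
        (at v within cball b 1)" for r
      using has_field_derivative_powr[OF ball(1)[OF v], of "of_real r"]
      by (simp add: has_field_derivative_at_within)
    from \<open>i \<le> 1\<close> consider "i = 0" | "i = 1" by linarith
    then show "(f i has_field_derivative f (Suc i) v) (at v within cball b 1)"
    proof cases
      case 1
      moreover have "f 0 = (\<lambda>v. v powr of_real p)"
        by (simp add: f_def fun_eq_iff)
      ultimately show ?thesis using deriv[of p] by (simp add: f_def)
    next
      case 2
      then show ?thesis
        using DERIV_cmult[OF deriv[of "p - 1"], of "of_real p"]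
        by (simp add: f_def[abs_def] mult.assoc algebra_simps)
    qed
  next
    fix v assume v: "v \<in> cball b 1"
    have "cmod v powr (p - 2) \<le> cmod v powr 0"
      using ball(2)[OF v] p by (intro powr_mono) auto
    then have "cmod v powr (p - 2) \<le> 1"
      by (simp split: if_splits)
    moreover have "\<bar>p\<bar> * \<bar>p - 1\<bar> \<le> 1 * 2"
      using p by (intro mult_mono) auto
    ultimately have "\<bar>p\<bar> * \<bar>p - 1\<bar> * cmod v powr (p - 2) \<le> (1 * 2) * 1"
      using mult_mono[of "\<bar>p\<bar> * \<bar>p - 1\<bar>" "1 * 2" "cmod v powr (p - 2)" 1] by simp
    then show "cmod (f (Suc 1) v) \<le> 2"
      unfolding f_def by (simp add: norm_mult norm_powr_of_real abs_mult del: of_real_mult of_real_diff)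
  qed (use h in \<open>auto simp: dist_norm\<close>)
  then show ?thesis
    by (simp add: f_def power2_eq_square algebra_simps)
qed

text \<open>The condition on \<open>\<kappa>\<close> absorbs a shift of z of size
  \<open>M + 1\<close>: \<open>M\<close> for \<open>\<rho> * U x\<close>, and 1 for the increments
  of z in difference quotients. Such a shift costs up to \<open>M + 1\<close> in the real part and
  as much again in the modulus, whence \<open>2 * M + 2\<close>.\<close>

locale sectorial_problem =
  fixes \<Omega> :: "'a::euclidean_space set" and U :: "'a \<Rightarrow> complex"
    and \<alpha> M \<theta> \<kappa> :: real and \<rho> :: complex
  assumes open_\<Omega>: "open \<Omega>" and bounded_\<Omega>: "bounded \<Omega>"
    and U_measurable: "U \<in> borel_measurable (lebesgue_on \<Omega>)"
    and U_bound: "\<And>x. x \<in> \<Omega> \<Longrightarrow> cmod (\<rho> * U x) \<le> M" and M: "0 \<le> M"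
    and \<alpha>: "0 < \<alpha>" "\<alpha> < 1"
    and \<theta>: "pi / 2 < \<theta>" "\<theta> < pi / (1 + \<alpha>)"
    and \<kappa>: "2 * M + 2 < \<kappa> * (cos \<theta> - cos (pi / (1 + \<alpha>)))"
begin

text \<open>\<open>\<beta>(z)\<close> stays in the sector of half-angle \<open>\<tau>\<close>, and \<open>\<alpha> * \<tau> < pi / 2\<close>, so that \<open>\<beta>(z) powr \<alpha>\<close>
  has positive real part and \<open>\<beta>(z) powr \<alpha> + A\<close> is coercive.\<close>

definition \<tau> :: real where "\<tau> = pi / (1 + \<alpha>)"

definition c0 :: real where "c0 = cos (\<alpha> * \<tau>)"

section \<open>Angles and the perturbed sector\<close>

lemma \<tau>: "0 < \<tau>" "\<theta> < \<tau>" "\<tau> < pi" "\<alpha> * \<tau> < pi / 2"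
proof -
  show "0 < \<tau>" "\<theta> < \<tau>" "\<tau> < pi" "\<alpha> * \<tau> < pi / 2"
    using \<alpha> \<theta> by (auto simp: \<tau>_def field_simps)
qed

lemma c0: "0 < c0" "c0 \<le> 1"
proof -
  have "0 < \<alpha> * \<tau>" using \<alpha> \<tau> by simp
  then show "0 < c0" "c0 \<le> 1"
    using \<tau>(4) unfolding c0_def by (auto intro!: cos_gt_zero)
qed

lemma cos_\<theta>\<tau>: "cos \<theta> < 0" "cos \<tau> < cos \<theta>" "cos \<theta> - cos \<tau> < 1"
proof -
  have "0 < \<theta>" using \<theta> pi_gt_zero by linarith
  show "cos \<theta> < 0"
    using cos_monotone_0_pi[of "pi / 2" \<theta>] \<theta> \<tau> by simp
  show "cos \<tau> < cos \<theta>"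
    using cos_monotone_0_pi[of \<theta> \<tau>] \<tau> \<open>0 < \<theta>\<close> by simp
  show "cos \<theta> - cos \<tau> < 1"
    using \<open>cos \<theta> < 0\<close> cos_ge_minus_one[of \<tau>] by linarith
qed

lemma \<kappa>_lower: "2 * M + 2 < \<kappa>" "2 < \<kappa>"
proof -
  have "0 < \<kappa>"
    using \<kappa> M cos_\<theta>\<tau>(2) unfolding \<tau>_def
    by (smt (verit) mult_nonpos_nonneg)
  then have "\<kappa> * (cos \<theta> - cos \<tau>) \<le> \<kappa> * 1"
    using cos_\<theta>\<tau>(3) by (intro mult_left_mono) auto
  with \<kappa> show "2 * M + 2 < \<kappa>"
    unfolding \<tau>_def by linarith
  with M show "2 < \<kappa>" by linarith
qed

text \<open>The inequality \<open>cos \<tau> * cmod b < Re b\<close> says that the argument of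
  \<open>b\<close> is below \<open>\<tau>\<close> in absolute value, in a form that can be checked
  under addition without computing arguments.\<close>

lemma sector_perturb:
  assumes z: "z \<in> sector \<theta> \<kappa>" and s: "cmod s \<le> M + 1"
  shows "cmod z / 2 \<le> cmod (z + s)" "cmod (z + s) \<le> 2 * cmod z"
    and "cos \<tau> * cmod (z + s) < Re (z + s)"
proof -
  have z\<kappa>: "\<kappa> \<le> cmod z" using z by (simp add: sector_def)
  have M1: "2 * M + 2 < cmod z" using z\<kappa> \<kappa>_lower by linarith
  have ge: "cmod z - (M + 1) \<le> cmod (z + s)"
    using norm_triangle_ineq4[of "z + s" s] s by simp
  then show "cmod z / 2 \<le> cmod (z + s)" using M1 by linarith
  show "cmod (z + s) \<le> 2 * cmod z"
    using norm_triangle_ineq[of z s] s M1 M by linarith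
  have "cos \<theta> \<le> cos \<bar>Arg z\<bar>"
    using z \<theta> \<tau> by (intro cos_monotone_0_pi_le) (auto simp: sector_def)
  then have "cmod z * cos \<theta> \<le> cmod z * cos (Arg z)"
    by (intro mult_left_mono) (auto simp: abs_if split: if_splits)
  also have "\<dots> = Re z"
    by (metis Re_rcis rcis_cmod_Arg)
  finally have "cmod z * cos \<theta> - (M + 1) \<le> Re (z + s)"
    using abs_Re_le_cmod[of s] s by simp
  \<comment> \<open>\<open>cos \<tau>\<close> is negative, so the lower bound for the modulus is the
    one that counts.\<close>
  moreover have "cos \<tau> * cmod (z + s) \<le> cos \<tau> * (cmod z - (M + 1))"
    using ge cos_\<theta>\<tau> by (intro mult_left_mono_neg) auto
  moreover have "2 * M + 2 < cmod z * (cos \<theta> - cos \<tau>)"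
  proof -
    have "\<kappa> * (cos \<theta> - cos \<tau>) \<le> cmod z * (cos \<theta> - cos \<tau>)"
      using z\<kappa> cos_\<theta>\<tau> by (intro mult_right_mono) auto
    with \<kappa> show ?thesis unfolding \<tau>_def by linarith
  qed
  moreover have "- (cos \<tau> * (M + 1)) \<le> 1 * (M + 1)"
    using M cos_ge_minus_one[of \<tau>] by (metis add_nonneg_nonneg minus_le_iff mult_minus_left mult_right_mono zero_le_one)
  ultimately show "cos \<tau> * cmod (z + s) < Re (z + s)"
    by (simp add: algebra_simps)
qed

lemma not_nonpos_Reals:
  assumes "cos \<tau> * cmod b < Re b"
  shows "b \<notin> \<real>\<^sub>\<le>\<^sub>0"
proof
  assume "b \<in> \<real>\<^sub>\<le>\<^sub>0"
  then have "Re b = - cmod b"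
    by (auto simp: nonpos_Reals_def)
  moreover have "- 1 * cmod b \<le> cos \<tau> * cmod b"
    by (intro mult_right_mono) auto
  ultimately show False
    using assms by simp
qed

text \<open>The principal power multiplies the argument by \<open>\<alpha>\<close>, so the argument
  of the power is at most \<open>\<alpha> * \<tau>\<close> in absolute value, and \<open>c0\<close>
  is the cosine of that extreme angle.\<close>

lemma Re_powr_lower:
  assumes "cos \<tau> * cmod b < Re b"
  shows "c0 * cmod b powr \<alpha> \<le> Re (b powr of_real \<alpha>)"
proof -
  have b: "b \<noteq> 0" using assms by auto
  have "Re b = cmod b * cos (Arg b)"
    by (metis Re_rcis rcis_cmod_Arg)
  with assms b have "cos \<tau> < cos \<bar>Arg b\<bar>"
    by (simp add: mult.commute abs_if)
  then have "\<bar>Arg b\<bar> \<le> \<tau>"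
    using cos_monotone_0_pi_le[of \<tau> "\<bar>Arg b\<bar>"] \<tau> Arg_bounded[of b] by (force simp: abs_le_iff)
  then have "c0 \<le> cos \<bar>\<alpha> * Arg b\<bar>"
    unfolding c0_def using \<alpha> \<tau> pi_gt_zero
    by (intro cos_monotone_0_pi_le) (auto simp: abs_mult)
  then have "c0 * cmod b powr \<alpha> \<le> cos (\<alpha> * Arg b) * cmod b powr \<alpha>"
    by (intro mult_right_mono) (auto simp: abs_if split: if_splits)
  also have "\<dots> = Re (b powr of_real \<alpha>)"
    using b by (simp add: powr_def Re_exp Arg_def)
  finally show ?thesis .
qed

section \<open>Bounds for the powers of \<beta>(z), the resolvent and the data\<close>

abbreviation pow :: "complex \<Rightarrow> real \<Rightarrow> 'a \<Rightarrow> complex" where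
  "pow z p x \<equiv> beta U \<rho> z x powr of_real p"

lemma pow_measurable: "pow z p \<in> borel_measurable (lebesgue_on \<Omega>)"
  using U_measurable unfolding beta_def powr_def by measurable

lemma beta_bounds:
  assumes "z \<in> sector \<theta> \<kappa>" "x \<in> \<Omega>"
  shows "cmod z / 2 \<le> cmod (beta U \<rho> z x)" "cmod (beta U \<rho> z x) \<le> 2 * cmod z"
    "cos \<tau> * cmod (beta U \<rho> z x) < Re (beta U \<rho> z x)"
  using sector_perturb[OF assms(1), of "\<rho> * U x"] U_bound[OF assms(2)] by (auto simp: beta_def)

lemma sector_cmod: "z \<in> sector \<theta> \<kappa> \<Longrightarrow> 2 < cmod z"
  using \<kappa>_lower by (auto simp: sector_def)

lemma Re_pow_lower:
  assumes z: "z \<in> sector \<theta> \<kappa>" and x: "x \<in> \<Omega>"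
  shows "c0 * (cmod z / 2) powr \<alpha> \<le> Re (pow z \<alpha> x)"
proof -
  have "c0 * (cmod z / 2) powr \<alpha> \<le> c0 * cmod (beta U \<rho> z x) powr \<alpha>"
    using beta_bounds(1)[OF assms] c0 \<alpha> by (intro mult_left_mono powr_mono2) auto
  also have "\<dots> \<le> Re (pow z \<alpha> x)"
    by (rule Re_powr_lower[OF beta_bounds(3)[OF assms]])
  finally show ?thesis .
qed

text \<open>The energy estimate with \<open>pow z \<alpha>\<close> as multiplier. The decaying bound
  serves the growth estimates of w; the uniform one, valid because \<open>cmod z / 2\<close> exceeds
  1, is enough for difference quotients.\<close>

lemma resolvent_estimate:
  assumes z: "z \<in> sector \<theta> \<kappa>" and "dirichlet_laplacian \<Omega> w f" "F \<in> L2 \<Omega>"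
    and "\<And>x. x \<in> \<Omega> \<Longrightarrow> f x = F x - pow z \<alpha> x * w x"
  shows "L2_norm \<Omega> w \<le> L2_norm \<Omega> F / (c0 * (cmod z / 2) powr \<alpha>)" and "L2_norm \<Omega> w \<le> L2_norm \<Omega> F / c0"
proof -
  have ge: "1 \<le> (cmod z / 2) powr \<alpha>"
    using sector_cmod[OF z] \<alpha> by (intro ge_one_powr_ge_zero) auto
  then have pos: "0 < c0 * (cmod z / 2) powr \<alpha>"
    using c0 by (intro mult_pos_pos) auto
  show le: "L2_norm \<Omega> w \<le> L2_norm \<Omega> F / (c0 * (cmod z / 2) powr \<alpha>)"
    by (rule dirichlet_laplacian_energy_estimate[OF open_\<Omega> bounded_\<Omega> assms(2-4) pos Re_pow_lower[OF z]])
  have "c0 * 1 \<le> c0 * (cmod z / 2) powr \<alpha>"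
    using c0 ge by (intro mult_left_mono) auto
  then have "L2_norm \<Omega> F / (c0 * (cmod z / 2) powr \<alpha>) \<le> L2_norm \<Omega> F / c0"
    using c0 pos by (intro divide_left_mono mult_pos_pos) auto
  with le show "L2_norm \<Omega> w \<le> L2_norm \<Omega> F / c0" by linarith
qed

lemma data_estimate:
  assumes z: "z \<in> sector \<theta> \<kappa>" and "G0 \<in> L2 \<Omega>"
  shows "(\<lambda>x. pow z (\<alpha> - 1) x * G0 x) \<in> L2 \<Omega>"
    and "L2_norm \<Omega> (\<lambda>x. pow z (\<alpha> - 1) x * G0 x) \<le> (cmod z / 2) powr (\<alpha> - 1) * L2_norm \<Omega> G0"
proof -
  have "cmod (pow z (\<alpha> - 1) x) \<le> (cmod z / 2) powr (\<alpha> - 1)" if "x \<in> \<Omega>" for x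
    unfolding norm_powr_of_real
    using beta_bounds(1)[OF z that] sector_cmod[OF z] \<alpha> by (intro powr_mono2') auto
  note bounded = L2_mult_bounded[OF assms(2) pow_measurable powr_ge_zero this]
  show "(\<lambda>x. pow z (\<alpha> - 1) x * G0 x) \<in> L2 \<Omega>"
    and "L2_norm \<Omega> (\<lambda>x. pow z (\<alpha> - 1) x * G0 x) \<le> (cmod z / 2) powr (\<alpha> - 1) * L2_norm \<Omega> G0"
    using bounded by auto
qed

section \<open>The transform w(z): decay and holomorphy\<close>

context
  fixes G0 :: "'a \<Rightarrow> complex" and w :: "complex \<Rightarrow> 'a \<Rightarrow> complex"
  assumes G0: "G0 \<in> L2 \<Omega>"
    and sol: "\<And>z. z \<in> sector \<theta> \<kappa> \<Longrightarrow> laplace_solution \<Omega> U \<alpha> \<rho> G0 z (w z)"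
begin

lemma solution_L2: "z \<in> sector \<theta> \<kappa> \<Longrightarrow> w z \<in> L2 \<Omega>"
  using sol dirichlet_laplacian_L2(1) unfolding laplace_solution_def by blast

text \<open>The exponent \<open>\<alpha> - 1\<close> of the data and \<open>- \<alpha>\<close> of
  the resolvent add up to \<open>- 1\<close>; the factor 2 stems from \<beta>(z) being at least
  \<open>cmod z / 2\<close> in modulus.\<close>

lemma solution_estimate:
  assumes z: "z \<in> sector \<theta> \<kappa>"
  shows "L2_norm \<Omega> (w z) \<le> 2 / c0 * L2_norm \<Omega> G0 * cmod z powr - 1"
proof -
  define r where "r = cmod z / 2"
  have r: "1 < r" using sector_cmod[OF z] by (simp add: r_def)
  have "L2_norm \<Omega> (w z) \<le> L2_norm \<Omega> (\<lambda>x. pow z (\<alpha> - 1) x * G0 x) / (c0 * r powr \<alpha>)"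
    unfolding r_def
    by (rule resolvent_estimate(1)[OF z sol[OF z, unfolded laplace_solution_def] data_estimate(1)[OF z G0]]) simp
  also have "\<dots> \<le> r powr (\<alpha> - 1) * L2_norm \<Omega> G0 / (c0 * r powr \<alpha>)"
    using data_estimate(2)[OF z G0] c0 unfolding r_def by (intro divide_right_mono) auto
  also have "\<dots> = 2 / c0 * L2_norm \<Omega> G0 * cmod z powr - 1"
    using r c0 unfolding r_def by (simp add: powr_diff powr_minus field_simps)
  finally show ?thesis .
qed

text \<open>By the equation, the function estimated here is A applied to \<open>w z\<close>. Both of
  its terms have order \<open>\<alpha> - 1\<close>, the second because the decay of
  \<open>w z\<close> offsets the growth of \<open>pow z \<alpha>\<close>.\<close>

lemma laplacian_estimate:
  assumes z: "z \<in> sector \<theta> \<kappa>"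
  shows "L2_norm \<Omega> (\<lambda>x. pow z (\<alpha> - 1) x * G0 x - pow z \<alpha> x * w z x)
    \<le> (2 + 4 / c0) * L2_norm \<Omega> G0 * cmod z powr (\<alpha> - 1)"
proof -
  define r where "r = cmod z"
  have r: "2 < r" using sector_cmod[OF z] by (simp add: r_def)
  have "cmod (pow z \<alpha> x) \<le> (2 * r) powr \<alpha>" if "x \<in> \<Omega>" for x
    unfolding norm_powr_of_real r_def using beta_bounds(2)[OF z that] \<alpha> by (intro powr_mono2) auto
  note bounded = L2_mult_bounded[OF solution_L2[OF z] pow_measurable powr_ge_zero this]
  have pow2: "(r / 2) powr (\<alpha> - 1) \<le> 2 * r powr (\<alpha> - 1)" "(2 * r) powr \<alpha> \<le> 2 * r powr \<alpha>"
  proof -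
    have "2 powr (1 - \<alpha>) \<le> 2 powr 1" "2 powr \<alpha> \<le> (2::real) powr 1"
      using \<alpha> by (intro powr_mono; simp)+
    then have le: "2 powr (1 - \<alpha>) \<le> (2::real)" "2 powr \<alpha> \<le> (2::real)"
      by simp_all
    have "(r / 2) powr (\<alpha> - 1) = 2 powr (1 - \<alpha>) * r powr (\<alpha> - 1)"
      using r by (simp add: powr_divide powr_diff field_simps)
    also have "\<dots> \<le> 2 * r powr (\<alpha> - 1)"
      by (rule mult_right_mono[OF le(1)]) simp
    finally show "(r / 2) powr (\<alpha> - 1) \<le> 2 * r powr (\<alpha> - 1)" .
    show "(2 * r) powr \<alpha> \<le> 2 * r powr \<alpha>"
      using r mult_right_mono[OF le(2), of "r powr \<alpha>"] by (simp add: powr_mult)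
  qed
  have "L2_norm \<Omega> (\<lambda>x. pow z (\<alpha> - 1) x * G0 x - pow z \<alpha> x * w z x)
      \<le> L2_norm \<Omega> (\<lambda>x. pow z (\<alpha> - 1) x * G0 x) + L2_norm \<Omega> (\<lambda>x. pow z \<alpha> x * w z x)"
    by (rule L2_norm_triangle_diff[OF data_estimate(1)[OF z G0] bounded(1)])
  also have "\<dots> \<le> (2 * r powr (\<alpha> - 1)) * L2_norm \<Omega> G0
      + (2 * r powr \<alpha>) * (2 / c0 * L2_norm \<Omega> G0 * r powr - 1)"
  proof (rule add_mono)
    show "L2_norm \<Omega> (\<lambda>x. pow z (\<alpha> - 1) x * G0 x) \<le> (2 * r powr (\<alpha> - 1)) * L2_norm \<Omega> G0"
      using data_estimate(2)[OF z G0] mult_right_mono[OF pow2(1), of "L2_norm \<Omega> G0"]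
      unfolding r_def by (rule order_trans) simp
    have "L2_norm \<Omega> (\<lambda>x. pow z \<alpha> x * w z x) \<le> (2 * r) powr \<alpha> * L2_norm \<Omega> (w z)"
      by (rule bounded(2))
    also have "\<dots> \<le> (2 * r powr \<alpha>) * (2 / c0 * L2_norm \<Omega> G0 * r powr - 1)"
      using solution_estimate[OF z] pow2(2) unfolding r_def[symmetric] by (intro mult_mono) auto
    finally show "L2_norm \<Omega> (\<lambda>x. pow z \<alpha> x * w z x)
      \<le> (2 * r powr \<alpha>) * (2 / c0 * L2_norm \<Omega> G0 * r powr - 1)" .
  qed
  also have "\<dots> = (2 + 4 / c0) * L2_norm \<Omega> G0 * r powr (\<alpha> - 1)"
    using r by (simp add: powr_diff powr_minus field_simps)
  finally show ?thesis unfolding r_def .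
qed

text \<open>The bounds are uniform in \<open>y\<close>, so they turn into bounds for multiplication
  on \<open>L2 \<Omega>\<close>. The constant 3 adds the bound 1 for the derivative to the error,
  which is at most 2 for distances below 1.\<close>

lemma pow_quotient:
  assumes z: "z \<in> sector \<theta> \<kappa>" and y: "y \<in> \<Omega>" and x: "x \<noteq> z" "dist x z < 1" and p: "\<bar>p\<bar> \<le> 1"
  shows "cmod ((pow x p y - pow z p y) / (x - z) - of_real p * pow z (p - 1) y) \<le> 2 * dist x z"
    and "cmod (of_real p * pow z (p - 1) y) \<le> 1"
    and "cmod ((pow x p y - pow z p y) / (x - z)) \<le> 3"
proof -
  let ?b = "beta U \<rho> z y" and ?h = "x - z"
  have h: "cmod ?h < 1" "?h \<noteq> 0" using x by (auto simp: dist_norm)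
  have near: "?b + k \<notin> \<real>\<^sub>\<le>\<^sub>0 \<and> 1 \<le> cmod (?b + k)" if "cmod k \<le> 1" for k
  proof -
    have "cmod (\<rho> * U y + k) \<le> M + 1"
      using U_bound[OF y] that norm_triangle_le by (meson add_mono)
    from sector_perturb[OF z this] not_nonpos_Reals show ?thesis
      using sector_cmod[OF z] unfolding beta_def add.assoc by fastforce
  qed
  have "cmod ((?b + ?h) powr of_real p - ?b powr of_real p - ?h * (of_real p * ?b powr of_real (p - 1)))
      \<le> 2 * (cmod ?h)\<^sup>2"
    using h near by (intro powr_Taylor_bound p) auto
  moreover have "?b + ?h = beta U \<rho> x y"
    by (simp add: beta_def)
  ultimately have "cmod (pow x p y - pow z p y - ?h * (of_real p * pow z (p - 1) y)) / cmod ?h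
      \<le> 2 * (cmod ?h)\<^sup>2 / cmod ?h"
    by (intro divide_right_mono) auto
  then show quot: "cmod ((pow x p y - pow z p y) / ?h - of_real p * pow z (p - 1) y) \<le> 2 * dist x z"
    using h unfolding norm_divide[symmetric] diff_divide_distrib[of _ _ ?h]
    by (simp add: power2_eq_square dist_norm)
  have "cmod ?b powr (p - 1) \<le> cmod ?b powr 0"
    using near[of 0] p by (intro powr_mono) auto
  then have "cmod ?b powr (p - 1) \<le> 1"
    by (simp split: if_splits)
  then have "\<bar>p\<bar> * cmod ?b powr (p - 1) \<le> 1 * 1"
    using p by (intro mult_mono) auto
  then show d: "cmod (of_real p * pow z (p - 1) y) \<le> 1"
    by (simp add: norm_mult norm_powr_of_real del: of_real_diff)
  show "cmod ((pow x p y - pow z p y) / ?h) \<le> 3"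
    using quot d norm_triangle_sub[of "(pow x p y - pow z p y) / ?h" "of_real p * pow z (p - 1) y"] x(2)
    by linarith
qed

text \<open>No solution operator is at hand to write down the derivative. Instead, the difference
  quotients of \<open>w\<close> solve resolvent equations with convergent right hand sides, so they are Cauchy.\<close>

lemma solution_holomorphic:
  assumes \<psi>: "\<psi> \<in> L2 \<Omega>"
  shows "(\<lambda>z. L2_inner \<Omega> (w z) \<psi>) holomorphic_on sector \<theta> \<kappa>"
  unfolding holomorphic_on_def
proof
  fix z assume z: "z \<in> sector \<theta> \<kappa>"
  define N where "N = L2_norm \<Omega> G0"
  \<comment> \<open>The difference quotient of \<open>w\<close>, written as a linear combination so
    that linearity of the Laplacian applies verbatim.\<close>
  define D where "D x y = 1 / (x - z) * w x y + - (1 / (x - z)) * w z y" for x y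
  define q where "q p x y = (pow x p y - pow z p y) / (x - z)" for p x y
  define d where "d p y = of_real p * pow z (p - 1) y" for p y
  \<comment> \<open>The right-hand side of the equation \<open>A D + pow z \<alpha> D = F\<close>,
    obtained by splitting the difference of the products \<open>pow x \<alpha> y * w x y\<close> and
    \<open>pow z \<alpha> y * w z y\<close> so that the power at \<open>z\<close> stays with
    \<open>D\<close>. \<open>F0\<close> is the limit of \<open>F x\<close> as \<open>x\<close> tends
    to \<open>z\<close>.\<close>
  define F where "F x y = q (\<alpha> - 1) x y * G0 y - q \<alpha> x y * w x y" for x y
  define F0 where "F0 y = d (\<alpha> - 1) y * G0 y - d \<alpha> y * w z y" for y
  define f where "f x y = pow x (\<alpha> - 1) y * G0 y - pow x \<alpha> y * w x y" for x y
  \<comment> \<open>\<open>K1\<close> bounds the quotients \<open>D x\<close>, which makes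
    \<open>w\<close> Lipschitz at \<open>z\<close>; \<open>K2\<close> is the resulting rate at which
    \<open>F x\<close> approaches \<open>F0\<close>.\<close>
  define K1 where "K1 = (3 * N + 3 * (N / c0)) / c0"
  define K2 where "K2 = 2 * N + (2 * (N / c0) + K1)"
  have dl: "dirichlet_laplacian \<Omega> (w x) (f x)" if "x \<in> sector \<theta> \<kappa>" for x
    using sol[OF that] unfolding laplace_solution_def f_def .
  have D: "dirichlet_laplacian \<Omega> (D x) (\<lambda>y. 1 / (x - z) * f x y + - (1 / (x - z)) * f z y)"
    if "x \<in> sector \<theta> \<kappa>" for x
    unfolding D_def by (rule dirichlet_laplacian_lincomb[OF open_\<Omega> bounded_\<Omega> dl[OF that] dl[OF z]])
  have eq: "1 / (x - z) * f x y + - (1 / (x - z)) * f z y = F x y - pow z \<alpha> y * D x y"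
    if "x \<noteq> z" for x y
  proof -
    define a b c d where "a = pow x (\<alpha> - 1) y" and "b = pow x \<alpha> y" and "c = pow z (\<alpha> - 1) y"
      and "d = pow z \<alpha> y"
    note abcd = a_def[symmetric] b_def[symmetric] c_def[symmetric] d_def[symmetric]
    show ?thesis
      unfolding f_def F_def q_def D_def abcd by (simp add: divide_inverse algebra_simps)
  qed
  have wN: "L2_norm \<Omega> (w x) \<le> N / c0" if "x \<in> sector \<theta> \<kappa>" for x
  proof -
    have "2 / c0 * N * cmod x powr - 1 \<le> N / c0"
    proof -
      have "2 * cmod x powr - 1 \<le> 1"
        using sector_cmod[OF that] by (simp add: powr_minus divide_inverse[symmetric] divide_le_eq)
      then have "N / c0 * (2 * cmod x powr - 1) \<le> N / c0 * 1"
        using c0 by (intro mult_left_mono) (auto simp: N_def)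
      then show ?thesis by (simp add: field_simps)
    qed
    with solution_estimate[OF that] show ?thesis unfolding N_def by linarith
  qed
  have measurable: "q p x \<in> borel_measurable (lebesgue_on \<Omega>)" "d p \<in> borel_measurable (lebesgue_on \<Omega>)"
    for p x
    unfolding q_def[abs_def] d_def[abs_def] using pow_measurable by measurable
  have p: "\<bar>\<alpha> - 1\<bar> \<le> 1" "\<bar>\<alpha>\<bar> \<le> 1" using \<alpha> by auto
  have near: "F x \<in> L2 \<Omega>" "L2_norm \<Omega> (\<lambda>y. F x y - F0 y) \<le> K2 * dist x z" "F0 \<in> L2 \<Omega>"
    if x: "x \<in> sector \<theta> \<kappa> - {z}" and xz: "dist x z < 1" for x
  proof -
    have xS: "x \<in> sector \<theta> \<kappa>" and xne: "x \<noteq> z" using x by auto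
    note quot = pow_quotient[OF z _ xne xz]
    note qG = L2_mult_bounded[OF G0 measurable(1), where K = 3, OF _ quot(3)[OF _ p(1), folded q_def]]
    note qw = L2_mult_bounded[OF solution_L2[OF xS] measurable(1), where K = 3,
        OF _ quot(3)[OF _ p(2), folded q_def]]
    show F: "F x \<in> L2 \<Omega>"
      unfolding F_def by (intro L2_diff qG(1) qw(1)) simp_all
    have "L2_norm \<Omega> (F x) \<le> 3 * N + 3 * (N / c0)"
    proof -
      have "L2_norm \<Omega> (F x) \<le> L2_norm \<Omega> (\<lambda>y. q (\<alpha> - 1) x y * G0 y) + L2_norm \<Omega> (\<lambda>y. q \<alpha> x y * w x y)"
        unfolding F_def by (intro L2_norm_triangle_diff qG(1) qw(1)) simp_all
      also have "\<dots> \<le> 3 * N + 3 * L2_norm \<Omega> (w x)"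
        unfolding N_def by (intro add_mono qG(2) qw(2)) simp_all
      also have "\<dots> \<le> 3 * N + 3 * (N / c0)"
        using wN[OF xS] by simp
      finally show ?thesis .
    qed
    then have "L2_norm \<Omega> (F x) / c0 \<le> K1"
      unfolding K1_def using c0 by (intro divide_right_mono) auto
    moreover have "L2_norm \<Omega> (D x) \<le> L2_norm \<Omega> (F x) / c0"
      by (rule resolvent_estimate(2)[OF z D[OF xS] F eq[OF xne]])
    ultimately have DK: "L2_norm \<Omega> (D x) \<le> K1" by linarith
    have wD: "w x y - w z y = (x - z) * D x y" for y
    proof -
      have "D x y = (w x y - w z y) / (x - z)"
        by (simp add: D_def diff_divide_distrib)
      then show ?thesis using xne by simp
    qed
    have dist: "L2_norm \<Omega> (\<lambda>y. w x y - w z y) \<le> dist x z * K1"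
      unfolding wD L2_norm_scale using DK by (simp add: dist_norm mult_left_mono)
    have wdiff: "(\<lambda>y. w x y - w z y) \<in> L2 \<Omega>"
      by (intro L2_diff solution_L2 xS z)
    have qd: "(\<lambda>y. q p x y - d p y) \<in> borel_measurable (lebesgue_on \<Omega>)" for p
      by (intro borel_measurable_diff measurable)
    note dG = L2_mult_bounded[OF G0 qd, where K = "2 * dist x z",
        OF _ quot(1)[OF _ p(1), folded q_def d_def]]
    note dw = L2_mult_bounded[OF solution_L2[OF xS] qd, where K = "2 * dist x z",
        OF _ quot(1)[OF _ p(2), folded q_def d_def]]
    note ddw = L2_mult_bounded[OF wdiff measurable(2), where K = 1,
        OF _ quot(2)[OF _ p(2), folded d_def]]
    \<comment> \<open>The first two terms are small by the Taylor error, the last by the Lipschitz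
      bound for \<open>w\<close> just obtained.\<close>
    have split: "F x y - F0 y = (q (\<alpha> - 1) x y - d (\<alpha> - 1) y) * G0 y
        - ((q \<alpha> x y - d \<alpha> y) * w x y + d \<alpha> y * (w x y - w z y))" for y
      by (simp add: F_def F0_def algebra_simps)
    have L2s: "(\<lambda>y. (q (\<alpha> - 1) x y - d (\<alpha> - 1) y) * G0 y) \<in> L2 \<Omega>"
      "(\<lambda>y. (q \<alpha> x y - d \<alpha> y) * w x y) \<in> L2 \<Omega>" "(\<lambda>y. d \<alpha> y * (w x y - w z y)) \<in> L2 \<Omega>"
      by (intro dG(1) dw(1) ddw(1); simp)+
    have "L2_norm \<Omega> (\<lambda>y. F x y - F0 y) \<le> L2_norm \<Omega> (\<lambda>y. (q (\<alpha> - 1) x y - d (\<alpha> - 1) y) * G0 y)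
        + L2_norm \<Omega> (\<lambda>y. (q \<alpha> x y - d \<alpha> y) * w x y + d \<alpha> y * (w x y - w z y))"
      unfolding split by (intro L2_norm_triangle_diff L2_add L2s)
    also have "\<dots> \<le> L2_norm \<Omega> (\<lambda>y. (q (\<alpha> - 1) x y - d (\<alpha> - 1) y) * G0 y)
        + (L2_norm \<Omega> (\<lambda>y. (q \<alpha> x y - d \<alpha> y) * w x y) + L2_norm \<Omega> (\<lambda>y. d \<alpha> y * (w x y - w z y)))"
      by (intro add_left_mono L2_norm_triangle L2s)
    also have "\<dots> \<le> 2 * dist x z * N + (2 * dist x z * (N / c0) + 1 * (dist x z * K1))"
    proof (intro add_mono)
      show "L2_norm \<Omega> (\<lambda>y. (q (\<alpha> - 1) x y - d (\<alpha> - 1) y) * G0 y) \<le> 2 * dist x z * N"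
        unfolding N_def by (intro dG(2)) simp_all
      have "L2_norm \<Omega> (\<lambda>y. (q \<alpha> x y - d \<alpha> y) * w x y) \<le> 2 * dist x z * L2_norm \<Omega> (w x)"
        by (intro dw(2)) simp_all
      also have "\<dots> \<le> 2 * dist x z * (N / c0)"
        using wN[OF xS] by (intro mult_left_mono) auto
      finally show "L2_norm \<Omega> (\<lambda>y. (q \<alpha> x y - d \<alpha> y) * w x y) \<le> 2 * dist x z * (N / c0)" .
      have "L2_norm \<Omega> (\<lambda>y. d \<alpha> y * (w x y - w z y)) \<le> 1 * L2_norm \<Omega> (\<lambda>y. w x y - w z y)"
        by (intro ddw(2)) simp_all
      with dist show "L2_norm \<Omega> (\<lambda>y. d \<alpha> y * (w x y - w z y)) \<le> 1 * (dist x z * K1)"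
        by linarith
    qed
    also have "\<dots> = K2 * dist x z"
      unfolding K2_def by (simp add: algebra_simps)
    finally show "L2_norm \<Omega> (\<lambda>y. F x y - F0 y) \<le> K2 * dist x z" .
    show "F0 \<in> L2 \<Omega>"
      unfolding F0_def
      using L2_mult_bounded(1)[OF G0 measurable(2), where K = 1, OF _ quot(2)[OF _ p(1), folded d_def]]
        L2_mult_bounded(1)[OF solution_L2[OF z] measurable(2), where K = 1, OF _ quot(2)[OF _ p(2), folded d_def]]
      by (intro L2_diff) auto
  qed
  show "(\<lambda>z. L2_inner \<Omega> (w z) \<psi>) field_differentiable at z within sector \<theta> \<kappa>"
  proof (rule field_differentiable_if_quotients_Cauchy)
    fix x y assume x: "x \<in> sector \<theta> \<kappa> - {z}" "dist x z < 1" and y: "y \<in> sector \<theta> \<kappa> - {z}" "dist y z < 1"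
    have DL2: "D x \<in> L2 \<Omega>" "D y \<in> L2 \<Omega>"
      using D x y dirichlet_laplacian_L2(1) by blast+
    have quot: "(L2_inner \<Omega> (w x) \<psi> - L2_inner \<Omega> (w z) \<psi>) / (x - z) = L2_inner \<Omega> (D x) \<psi>"
      if "x \<in> sector \<theta> \<kappa> - {z}" for x
    proof -
      have "L2_inner \<Omega> (D x) \<psi> = 1 / (x - z) * L2_inner \<Omega> (w x) \<psi> + - (1 / (x - z)) * L2_inner \<Omega> (w z) \<psi>"
        unfolding D_def using that z \<psi>
        by (subst L2_inner_add_left) (auto intro!: L2_scale solution_L2 simp only: L2_inner_scale_left)
      then show ?thesis
        by (simp add: diff_divide_distrib)
    qed
    \<comment> \<open>Both quotients solve an equation with the same operator at \<open>z\<close>,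
      so their difference solves it with right-hand side \<open>F x - F y\<close>, which is then
      compared through \<open>F0\<close>.\<close>
    have "dirichlet_laplacian \<Omega> (\<lambda>v. 1 * D x v + - 1 * D y v)
        (\<lambda>v. 1 * (1 / (x - z) * f x v + - (1 / (x - z)) * f z v)
             + - 1 * (1 / (y - z) * f y v + - (1 / (y - z)) * f z v))"
      using x y by (intro dirichlet_laplacian_lincomb[OF open_\<Omega> bounded_\<Omega>] D) auto
    moreover have "1 * (1 / (x - z) * f x v + - (1 / (x - z)) * f z v)
        + - 1 * (1 / (y - z) * f y v + - (1 / (y - z)) * f z v)
      = (F x v - F y v) - pow z \<alpha> v * (1 * D x v + - 1 * D y v)" for v
      using x y by (subst (1 2) eq) (auto simp: algebra_simps)
    ultimately have "L2_norm \<Omega> (\<lambda>v. 1 * D x v + - 1 * D y v) \<le> L2_norm \<Omega> (\<lambda>v. F x v - F y v) / c0"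
      by (intro resolvent_estimate(2)[OF z _ L2_diff[OF near(1)[OF x] near(1)[OF y]]]) auto
    also have "L2_norm \<Omega> (\<lambda>v. F x v - F y v) = L2_norm \<Omega> (\<lambda>v. (F x v - F0 v) - (F y v - F0 v))"
      by simp
    also have "\<dots> \<le> L2_norm \<Omega> (\<lambda>v. F x v - F0 v) + L2_norm \<Omega> (\<lambda>v. F y v - F0 v)"
      by (intro L2_norm_triangle_diff L2_diff near[OF x] near[OF y])
    also have "\<dots> \<le> K2 * dist x z + K2 * dist y z"
      by (intro add_mono near x y)
    finally have le: "L2_norm \<Omega> (\<lambda>v. D x v - D y v) \<le> (K2 * dist x z + K2 * dist y z) / c0"
      using c0 by (simp add: divide_right_mono)
    have "dist (L2_inner \<Omega> (D x) \<psi>) (L2_inner \<Omega> (D y) \<psi>) = cmod (L2_inner \<Omega> (\<lambda>v. D x v - D y v) \<psi>)"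
      by (simp add: dist_norm L2_inner_diff_left DL2 \<psi>)
    also have "\<dots> \<le> L2_norm \<Omega> (\<lambda>v. D x v - D y v) * L2_norm \<Omega> \<psi>"
      by (intro L2_Cauchy_Schwarz L2_diff DL2 \<psi>)
    also have "\<dots> \<le> (K2 * dist x z + K2 * dist y z) / c0 * L2_norm \<Omega> \<psi>"
      by (intro mult_right_mono le) simp
    also have "\<dots> = K2 / c0 * L2_norm \<Omega> \<psi> * (dist x z + dist y z)"
      by (simp add: field_simps)
    finally show "dist ((L2_inner \<Omega> (w x) \<psi> - L2_inner \<Omega> (w z) \<psi>) / (x - z))
        ((L2_inner \<Omega> (w y) \<psi> - L2_inner \<Omega> (w z) \<psi>) / (y - z))
        \<le> K2 / c0 * L2_norm \<Omega> \<psi> * (dist x z + dist y z)"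
      unfolding quot[OF x(1)] quot[OF y(1)] .
  qed simp
qed

end

end

subsection \<open>Expansion in eigenfunctions\<close>

lemma orthonormal_lincomb:
  fixes \<phi> :: "nat \<Rightarrow> 'a::euclidean_space \<Rightarrow> complex"
  assumes "\<And>j. \<phi> j \<in> L2 \<Omega>" "\<And>i j. L2_inner \<Omega> (\<phi> i) (\<phi> j) = (if i = j then 1 else 0)"
  shows "(L2_norm \<Omega> (\<lambda>x. \<Sum>j<n. a j * \<phi> j x))\<^sup>2 = (\<Sum>j<n. (cmod (a j))\<^sup>2)"
proof -
  have "L2_inner \<Omega> (\<lambda>x. \<Sum>j<n. a j * \<phi> j x) (\<lambda>x. \<Sum>j<n. a j * \<phi> j x)
      = (\<Sum>i<n. \<Sum>j<n. a i * (cnj (a j) * (if i = j then 1 else 0)))"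
    by (simp add: L2_inner_sum_left L2_inner_sum_right L2_sum L2_scale L2_inner_scale_left
        L2_inner_scale_right assms sum_distrib_left)
  also have "\<dots> = (\<Sum>i<n. a i * cnj (a i))"
    by (intro sum.cong refl) (simp add: mult_delta_right)
  also have "\<dots> = of_real (\<Sum>j<n. (cmod (a j))\<^sup>2)"
    by (simp only: of_real_sum complex_norm_square)
  finally show ?thesis
    unfolding L2_inner_self of_real_eq_iff .
qed

text \<open>Duality in finite dimension: choosing \<open>d j\<close> as the weighted coefficient
  itself gives \<open>s \<le> Q * sqrt s\<close> for the sum \<open>s\<close>. With
  \<open>m j = lam j\<close> this controls A v coefficientwise without placing \<open>v\<close> in
  the domain of A.\<close>

lemma weighted_coefficients_bound:
  fixes \<phi> :: "nat \<Rightarrow> 'a::euclidean_space \<Rightarrow> complex"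
  assumes \<phi>: "\<And>j. \<phi> j \<in> L2 \<Omega>" and v: "v \<in> L2 \<Omega>"
    and le: "\<And>d. cmod (L2_inner \<Omega> v (\<lambda>x. \<Sum>j<n. of_real (m j) * d j * \<phi> j x))
               \<le> Q * sqrt (\<Sum>j<n. (cmod (d j))\<^sup>2)"
  shows "(\<Sum>j<n. (m j)\<^sup>2 * (cmod (L2_inner \<Omega> v (\<phi> j)))\<^sup>2) \<le> Q\<^sup>2"
proof -
  define c where "c j = L2_inner \<Omega> v (\<phi> j)" for j
  define s where "s = (\<Sum>j<n. (m j)\<^sup>2 * (cmod (c j))\<^sup>2)"
  have s: "0 \<le> s" by (simp add: s_def sum_nonneg)
  have "L2_inner \<Omega> v (\<lambda>x. \<Sum>j<n. of_real (m j) * (of_real (m j) * c j) * \<phi> j x)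
      = (\<Sum>j<n. of_real ((m j)\<^sup>2) * (c j * cnj (c j)))"
    by (simp add: L2_inner_sum_right L2_scale \<phi> v L2_inner_scale_right c_def[symmetric]
        power2_eq_square mult_ac)
  also have "\<dots> = of_real s"
    by (simp only: s_def of_real_sum of_real_mult complex_norm_square)
  finally have "s = cmod (L2_inner \<Omega> v (\<lambda>x. \<Sum>j<n. of_real (m j) * (of_real (m j) * c j) * \<phi> j x))"
    using s by simp
  also have "\<dots> \<le> Q * sqrt (\<Sum>j<n. (cmod (of_real (m j) * c j))\<^sup>2)"
    by (rule le)
  also have "(\<Sum>j<n. (cmod (of_real (m j) * c j))\<^sup>2) = s"
    by (simp add: s_def norm_mult power_mult_distrib)
  finally have "sqrt s * sqrt s \<le> Q * sqrt s"
    using s by simp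
  then have "sqrt s \<le> \<bar>Q\<bar>"
  proof (cases "s = 0")
    case False
    then have "0 < sqrt s" using s by simp
    with \<open>sqrt s * sqrt s \<le> Q * sqrt s\<close> have "sqrt s \<le> Q"
      by (rule mult_right_le_imp_le)
    then show ?thesis by linarith
  qed simp
  from sqrt_le_D[OF this] have "s \<le> Q\<^sup>2"
    by simp
  then show ?thesis
    unfolding s_def c_def .
qed

lemma eigenvalue_nonneg:
  assumes "open \<Omega>" "bounded \<Omega>" "dirichlet_eigensystem \<Omega> lam \<phi>"
  shows "0 \<le> lam j"
proof -
  have "dirichlet_laplacian \<Omega> (\<phi> j) (\<lambda>x. of_real (lam j) * \<phi> j x)" "L2_inner \<Omega> (\<phi> j) (\<phi> j) = 1"
    using assms(3) by (auto simp: dirichlet_eigensystem_def)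
  with dirichlet_laplacian_nonneg[OF assms(1,2)] show ?thesis
    by (fastforce simp: L2_inner_scale_left)
qed

section \<open>The estimate for G(t)\<close>

context sectorial_problem
begin

lemma solution_smoothing:
  assumes G0: "G0 \<in> L2 \<Omega>" and sol: "is_solution \<Omega> U \<alpha> \<rho> T \<theta> \<kappa> G0 G"
    and eig: "dirichlet_eigensystem \<Omega> lam \<phi>" and t: "0 < t" "t \<le> T"
    and \<sigma>: "0 \<le> \<sigma>" "\<sigma> \<le> 2"
    and C: "C = (2 + 4 / c0) * (2 * \<theta> * max 1 (\<kappa> * T) * exp (max 1 (\<kappa> * T)) + 2 / \<bar>cos \<theta>\<bar>)"
  shows "G t \<in> Hdot \<Omega> lam \<phi> \<sigma>"
    and "Hdot_norm \<Omega> lam \<phi> \<sigma> (G t) \<le> 2 * C * t powr (- (\<sigma> * \<alpha> / 2)) * L2_norm \<Omega> G0"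
proof -
  define K where "K = 2 * \<theta> * max 1 (\<kappa> * T) * exp (max 1 (\<kappa> * T)) + 2 / \<bar>cos \<theta>\<bar>"
  define N where "N = L2_norm \<Omega> G0"
  define c where "c j = L2_inner \<Omega> (G t) (\<phi> j)" for j
  have "0 < \<theta>" using \<theta> pi_gt_zero by linarith
  have K: "0 \<le> K" "C = (2 + 4 / c0) * K"
    using \<open>0 < \<theta>\<close> by (auto simp: K_def C intro!: add_nonneg_nonneg mult_nonneg_nonneg)
  have C0: "0 \<le> C" using K c0 by simp
  have \<theta>pi: "\<theta> < pi" using \<tau> by linarith
  have \<kappa>0: "0 < \<kappa>" using \<kappa>_lower by simp
  have \<phi>: "\<And>j. dirichlet_laplacian \<Omega> (\<phi> j) (\<lambda>x. of_real (lam j) * \<phi> j x)"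
      "\<And>i j. L2_inner \<Omega> (\<phi> i) (\<phi> j) = (if i = j then 1 else 0)"
    using eig by (auto simp: dirichlet_eigensystem_def)
  have \<phi>L2: "\<phi> j \<in> L2 \<Omega>" for j
    using \<phi>(1) by (rule dirichlet_laplacian_L2)
  obtain w where w: "\<And>z. z \<in> sector \<theta> \<kappa> \<Longrightarrow> laplace_solution \<Omega> U \<alpha> \<rho> G0 z (w z)"
    and G: "\<And>t. t \<in> {0<..T} \<Longrightarrow> G t \<in> L2 \<Omega> \<and> (\<forall>\<psi>\<in>L2 \<Omega>.
        hankel_integrable \<theta> \<kappa> (\<lambda>z. exp (z * of_real t) * L2_inner \<Omega> (w z) \<psi>) \<and>
        L2_inner \<Omega> (G t) \<psi> = 1 / (2 * of_real pi * \<i>) *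
          hankel_integral \<theta> \<kappa> (\<lambda>z. exp (z * of_real t) * L2_inner \<Omega> (w z) \<psi>))"
    using sol unfolding is_solution_def by blast
  have GL2: "G t \<in> L2 \<Omega>"
    using G t by simp
  note wL2 = solution_L2[OF G0 w]
  \<comment> \<open>G(t) is known only through its pairings, each a scalar contour integral to which
    the decay estimate applies. The prefactor \<open>1 / (2 * pi)\<close> is bounded by 1.\<close>
  have pairing: "cmod (L2_inner \<Omega> (G t) \<psi>) \<le> B * K * t powr (- p - 1)"
    if \<psi>: "\<psi> \<in> L2 \<Omega>" and "p \<le> 0" "0 \<le> B"
      and B: "\<And>z. z \<in> sector \<theta> \<kappa> \<Longrightarrow> cmod (L2_inner \<Omega> (w z) \<psi>) \<le> B * cmod z powr p" for \<psi> B p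
  proof -
    define I where "I = hankel_integral \<theta> \<kappa> (\<lambda>z. exp (z * of_real t) * L2_inner \<Omega> (w z) \<psi>)"
    have "cmod I \<le> B * K * t powr (- p - 1)"
      unfolding I_def K_def
      using G[of t] t \<psi> \<open>p \<le> 0\<close> \<open>0 \<le> B\<close> \<kappa>0 \<theta>(1) \<theta>pi B
      by (intro hankel_integral_decay solution_holomorphic[OF G0 w]) auto
    moreover have "cmod (1 / (2 * of_real pi * \<i>) * I) = cmod I / (2 * pi)"
      by (simp add: norm_mult norm_divide)
    moreover have "cmod I / (2 * pi) \<le> cmod I / 1"
      using pi_ge_two by (intro divide_left_mono) auto
    ultimately show ?thesis
      using G[of t] t \<psi> unfolding I_def by auto
  qed
  have sum0: "(\<Sum>j<n. 1\<^sup>2 * (cmod (c j))\<^sup>2) \<le> (C * N)\<^sup>2" for n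
    unfolding c_def
  proof (rule weighted_coefficients_bound[OF \<phi>L2 GL2])
    fix d :: "nat \<Rightarrow> complex"
    define S where "S = sqrt (\<Sum>j<n. (cmod (d j))\<^sup>2)"
    let ?\<psi> = "\<lambda>x. \<Sum>j<n. of_real 1 * d j * \<phi> j x"
    have \<psi>: "?\<psi> \<in> L2 \<Omega>" by (intro L2_sum L2_scale \<phi>L2)
    have S: "L2_norm \<Omega> ?\<psi> = S"
      using orthonormal_lincomb[OF \<phi>L2 \<phi>(2), of d n] unfolding S_def
      by (simp add: real_sqrt_unique)
    have "cmod (L2_inner \<Omega> (G t) ?\<psi>) \<le> ((2 + 4 / c0) * N * S) * K * t powr (- (- 1) - 1)"
    proof (rule pairing[OF \<psi>])
      show "0 \<le> (2 + 4 / c0) * N * S"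
        using c0 unfolding N_def S[symmetric] by simp
      fix z assume z: "z \<in> sector \<theta> \<kappa>"
      have "cmod (L2_inner \<Omega> (w z) ?\<psi>) \<le> L2_norm \<Omega> (w z) * S"
        using L2_Cauchy_Schwarz[OF wL2[OF _ z] \<psi>] unfolding S by simp
      also have "\<dots> \<le> (2 / c0 * N * cmod z powr - 1) * S"
        using solution_estimate[OF G0 w z] unfolding N_def S[symmetric] by (intro mult_right_mono) auto
      also have "\<dots> = 2 / c0 * (N * S * cmod z powr - 1)" by simp
      \<comment> \<open>Enlarged to the constant of \<open>laplacian_estimate\<close>, so that both
        sums share \<open>C\<close>.\<close>
      also have "\<dots> \<le> (2 + 4 / c0) * (N * S * cmod z powr - 1)"
        using c0 by (intro mult_right_mono) (auto simp: N_def S[symmetric] field_simps)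
      finally show "cmod (L2_inner \<Omega> (w z) ?\<psi>) \<le> (2 + 4 / c0) * N * S * cmod z powr - 1"
        by (simp add: mult_ac)
    qed simp
    then show "cmod (L2_inner \<Omega> (G t) ?\<psi>) \<le> C * N * sqrt (\<Sum>j<n. (cmod (d j))\<^sup>2)"
      using t unfolding S_def[symmetric] K(2) by (simp add: mult_ac)
  qed
  \<comment> \<open>The decay exponent is now \<open>\<alpha> - 1\<close>, which the contour
    integral converts into \<open>t powr - \<alpha>\<close>; in \<open>sum0\<close> the exponent
    \<open>- 1\<close> gave order zero.\<close>
  have sum2: "(\<Sum>j<n. (lam j)\<^sup>2 * (cmod (c j))\<^sup>2) \<le> (C * N * t powr - \<alpha>)\<^sup>2" for n
    unfolding c_def
  proof (rule weighted_coefficients_bound[OF \<phi>L2 GL2])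
    fix d :: "nat \<Rightarrow> complex"
    define S where "S = sqrt (\<Sum>j<n. (cmod (d j))\<^sup>2)"
    let ?\<psi> = "\<lambda>x. \<Sum>j<n. of_real (lam j) * d j * \<phi> j x"
    let ?\<eta> = "\<lambda>x. \<Sum>j<n. d j * \<phi> j x"
    have L2: "?\<psi> \<in> L2 \<Omega>" "?\<eta> \<in> L2 \<Omega>"
      by (intro L2_sum L2_scale \<phi>L2)+
    have S: "L2_norm \<Omega> ?\<eta> = S"
      using orthonormal_lincomb[OF \<phi>L2 \<phi>(2), of d n] unfolding S_def
      by (simp add: real_sqrt_unique)
    have "cmod (L2_inner \<Omega> (G t) ?\<psi>) \<le> ((2 + 4 / c0) * N * S) * K * t powr (- (\<alpha> - 1) - 1)"
    proof (rule pairing[OF L2(1)])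
      show "0 \<le> (2 + 4 / c0) * N * S"
        using c0 unfolding N_def S[symmetric] by simp
      fix z assume z: "z \<in> sector \<theta> \<kappa>"
      define f where "f = (\<lambda>x. pow z (\<alpha> - 1) x * G0 x - pow z \<alpha> x * w z x)"
      have dl: "dirichlet_laplacian \<Omega> (w z) f"
        using w[OF z] unfolding laplace_solution_def f_def .
      have "L2_inner \<Omega> f (\<phi> j) = of_real (lam j) * L2_inner \<Omega> (w z) (\<phi> j)" for j
        using dirichlet_laplacian_symmetric[OF open_\<Omega> bounded_\<Omega> dl \<phi>(1)]
        by (simp add: L2_inner_scale_right)
      \<comment> \<open>\<open>?\<psi>\<close> is A applied to \<open>?\<eta>\<close> and
        \<open>f\<close> is A applied to \<open>w z\<close>; symmetry exchanges them.\<close>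
      then have "L2_inner \<Omega> (w z) ?\<psi> = L2_inner \<Omega> f ?\<eta>"
        using dirichlet_laplacian_L2[OF dl]
        by (simp add: L2_inner_sum_right L2_scale \<phi>L2 L2_inner_scale_right mult_ac)
      also have "cmod \<dots> \<le> L2_norm \<Omega> f * S"
        using L2_Cauchy_Schwarz[OF dirichlet_laplacian_L2(2)[OF dl] L2(2)] unfolding S .
      also have "\<dots> \<le> ((2 + 4 / c0) * N * cmod z powr (\<alpha> - 1)) * S"
        using laplacian_estimate[OF G0 w z] unfolding f_def N_def S[symmetric]
        by (intro mult_right_mono) auto
      finally show "cmod (L2_inner \<Omega> (w z) ?\<psi>) \<le> (2 + 4 / c0) * N * S * cmod z powr (\<alpha> - 1)"
        by (simp add: mult_ac)
    qed (use \<alpha> in simp)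
    then show "cmod (L2_inner \<Omega> (G t) ?\<psi>) \<le> C * N * t powr - \<alpha> * sqrt (\<Sum>j<n. (cmod (d j))\<^sup>2)"
      unfolding S_def[symmetric] K(2) by (simp add: mult_ac)
  qed
  have sum\<sigma>: "(\<Sum>j<n. lam j powr \<sigma> * (cmod (c j))\<^sup>2) \<le> 2 * (C * N * t powr (- (\<sigma> * \<alpha> / 2)))\<^sup>2" for n
  proof -
    \<comment> \<open>Interpolation in the scaled eigenvalue \<open>y\<close>:
      \<open>y powr \<sigma> \<le> 1 + y\<^sup>2\<close> for \<sigma> between 0 and 2. The scaling
      by \<open>t powr \<alpha>\<close> gives the two sums equal weight. At \<open>y = 0\<close> the
      power is 0 for every \<sigma>.\<close>
    have "lam j powr \<sigma> \<le> t powr (- (\<sigma> * \<alpha>)) * (1 + t powr (2 * \<alpha>) * (lam j)\<^sup>2)" for j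
    proof -
      define y where "y = lam j * t powr \<alpha>"
      have y: "0 \<le> y" "0 \<le> lam j"
        using eigenvalue_nonneg[OF open_\<Omega> bounded_\<Omega> eig] by (auto simp: y_def)
      have "y powr \<sigma> \<le> 1 + y\<^sup>2"
      proof (cases "y \<le> 1")
        case True
        then have "y powr \<sigma> \<le> 1"
          using y \<sigma> by (intro powr_le1) auto
        then show ?thesis by (simp add: add_increasing2)
      next
        case False
        then have "y powr \<sigma> \<le> y powr 2"
          using \<sigma> by (intro powr_mono) auto
        with False show ?thesis by simp
      qed
      moreover have "y powr \<sigma> = lam j powr \<sigma> * t powr (\<sigma> * \<alpha>)"
        using y t by (simp add: y_def powr_mult powr_powr mult.commute)
      moreover have "y\<^sup>2 = t powr (2 * \<alpha>) * (lam j)\<^sup>2"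
        using t by (simp add: y_def power_mult_distrib powr_power mult.commute)
      ultimately show ?thesis
        using t by (simp add: powr_minus field_simps)
    qed
    then have "(\<Sum>j<n. lam j powr \<sigma> * (cmod (c j))\<^sup>2)
        \<le> (\<Sum>j<n. t powr (- (\<sigma> * \<alpha>)) * (1 + t powr (2 * \<alpha>) * (lam j)\<^sup>2) * (cmod (c j))\<^sup>2)"
      by (intro sum_mono mult_right_mono) auto
    also have "\<dots> = t powr (- (\<sigma> * \<alpha>)) * ((\<Sum>j<n. 1\<^sup>2 * (cmod (c j))\<^sup>2)
        + t powr (2 * \<alpha>) * (\<Sum>j<n. (lam j)\<^sup>2 * (cmod (c j))\<^sup>2))"
      by (simp add: sum_distrib_left sum.distrib algebra_simps)
    also have "\<dots> \<le> t powr (- (\<sigma> * \<alpha>)) * ((C * N)\<^sup>2 + t powr (2 * \<alpha>) * (C * N * t powr - \<alpha>)\<^sup>2)"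
      by (intro mult_left_mono add_mono sum0 sum2) auto
    also have "t powr (2 * \<alpha>) * (C * N * t powr - \<alpha>)\<^sup>2 = (C * N)\<^sup>2"
      using t by (simp add: power_mult_distrib powr_power powr_minus field_simps)
    also have "t powr (- (\<sigma> * \<alpha>)) * ((C * N)\<^sup>2 + (C * N)\<^sup>2) = 2 * (C * N * t powr (- (\<sigma> * \<alpha> / 2)))\<^sup>2"
      using t by (simp add: power_mult_distrib powr_power)
    finally show ?thesis .
  qed
  have summable: "summable (\<lambda>j. lam j powr \<sigma> * (cmod (c j))\<^sup>2)"
    by (intro summableI_nonneg_bounded[OF _ sum\<sigma>]) simp
  then show "G t \<in> Hdot \<Omega> lam \<phi> \<sigma>"
    using GL2 by (simp add: Hdot_def c_def)
  have "(\<Sum>j. lam j powr \<sigma> * (cmod (c j))\<^sup>2) \<le> 2 * (C * N * t powr (- (\<sigma> * \<alpha> / 2)))\<^sup>2"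
    by (intro suminf_le_const summable sum\<sigma>)
  \<comment> \<open>Replacing 2 by its square avoids a factor \<open>sqrt 2\<close> in the final
    constant.\<close>
  also have "\<dots> \<le> (2 * (C * N * t powr (- (\<sigma> * \<alpha> / 2))))\<^sup>2"
    unfolding power_mult_distrib[of 2] by (intro mult_right_mono) auto
  finally have "Hdot_norm \<Omega> lam \<phi> \<sigma> (G t) \<le> \<bar>2 * (C * N * t powr (- (\<sigma> * \<alpha> / 2)))\<bar>"
    unfolding Hdot_norm_def c_def real_sqrt_abs[symmetric] by (rule real_sqrt_le_mono)
  also have "\<dots> = 2 * C * t powr (- (\<sigma> * \<alpha> / 2)) * L2_norm \<Omega> G0"
    using C0 by (simp add: N_def abs_mult)
  finally show "Hdot_norm \<Omega> lam \<phi> \<sigma> (G t) \<le> 2 * C * t powr (- (\<sigma> * \<alpha> / 2)) * L2_norm \<Omega> G0" .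
qed

end

theorem theorem2p1:
  fixes \<Omega> :: "'a::euclidean_space set" and U :: "'a \<Rightarrow> complex"
    and \<alpha> T :: real and \<rho> :: complex
    and lam :: "nat \<Rightarrow> real" and \<phi> :: "nat \<Rightarrow> 'a \<Rightarrow> complex"
  assumes "open \<Omega>" and "connected \<Omega>" and "\<Omega> \<noteq> {}" and "bounded \<Omega>"
    and "dirichlet_eigensystem \<Omega> lam \<phi>"
    and "0 < \<alpha>" and "\<alpha> < 1" and "0 < T"
    and "U \<in> borel_measurable (lebesgue_on \<Omega>)" and "bounded (U ` closure \<Omega>)"
  shows "\<forall>\<^sub>F \<theta> in at_right (pi/2). \<forall>\<^sub>F \<kappa> in at_top.
           \<exists>C>0. \<forall>G0\<in>L2 \<Omega>. \<forall>G. is_solution \<Omega> U \<alpha> \<rho> T \<theta> \<kappa> G0 G \<longrightarrow>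
             (\<forall>\<sigma>\<in>{0..2}. \<forall>t\<in>{0<..T}.
                G t \<in> Hdot \<Omega> lam \<phi> \<sigma> \<and>
                Hdot_norm \<Omega> lam \<phi> \<sigma> (G t) \<le> C * t powr (- (\<sigma> * \<alpha> / 2)) * L2_norm \<Omega> G0)"
proof -
  obtain B where B: "\<And>x. x \<in> closure \<Omega> \<Longrightarrow> cmod (U x) \<le> B"
    using \<open>bounded (U ` closure \<Omega>)\<close> by (auto simp: bounded_iff)
  define M where "M = cmod \<rho> * \<bar>B\<bar>"
  have "cmod (\<rho> * U x) \<le> M" if "x \<in> \<Omega>" for x
  proof -
    have "cmod (U x) \<le> \<bar>B\<bar>"
      using B[of x] closure_subset that by force
    then show ?thesis
      unfolding M_def norm_mult by (intro mult_left_mono) auto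
  qed
  define \<tau> where "\<tau> = pi / (1 + \<alpha>)"
  have "0 \<le> M" by (simp add: M_def)
  have "pi / 2 < \<tau>" "\<tau> < pi"
    using \<open>0 < \<alpha>\<close> \<open>\<alpha> < 1\<close> by (auto simp: \<tau>_def field_simps)
  \<comment> \<open>The threshold for \<open>\<kappa>\<close> blows up as \<theta> approaches
    \<open>\<tau>\<close>, so \<theta> has to be fixed before \<open>\<kappa>\<close> is sent to
    infinity.\<close>
  have problem: "sectorial_problem \<Omega> U \<alpha> M \<theta> \<kappa> \<rho>"
    if "pi / 2 < \<theta>" "\<theta> < \<tau>" "(2 * M + 2) / (cos \<theta> - cos \<tau>) < \<kappa>" for \<theta> \<kappa>
  proof -
    have "0 < \<theta>" using that pi_gt_zero by linarith
    then have "cos \<tau> < cos \<theta>"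
      using that \<open>\<tau> < pi\<close> by (intro cos_monotone_0_pi) auto
    with that(3) have "2 * M + 2 < \<kappa> * (cos \<theta> - cos \<tau>)"
      by (simp add: pos_divide_less_eq)
    with that assms \<open>0 \<le> M\<close> \<open>\<And>x. x \<in> \<Omega> \<Longrightarrow> cmod (\<rho> * U x) \<le> M\<close> show ?thesis
      unfolding \<tau>_def by unfold_locales
  qed
  have bound: "\<exists>C>0. \<forall>G0\<in>L2 \<Omega>. \<forall>G. is_solution \<Omega> U \<alpha> \<rho> T \<theta> \<kappa> G0 G \<longrightarrow>
      (\<forall>\<sigma>\<in>{0..2}. \<forall>t\<in>{0<..T}. G t \<in> Hdot \<Omega> lam \<phi> \<sigma> \<and>
         Hdot_norm \<Omega> lam \<phi> \<sigma> (G t) \<le> C * t powr (- (\<sigma> * \<alpha> / 2)) * L2_norm \<Omega> G0)"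
    if \<theta>: "pi / 2 < \<theta>" "\<theta> < \<tau>" and "(2 * M + 2) / (cos \<theta> - cos \<tau>) < \<kappa>" for \<theta> \<kappa>
  proof -
    interpret sectorial_problem \<Omega> U \<alpha> M \<theta> \<kappa> \<rho>
      by (rule problem[OF that])
    define C where
      "C = (2 + 4 / c0) * (2 * \<theta> * max 1 (\<kappa> * T) * exp (max 1 (\<kappa> * T)) + 2 / \<bar>cos \<theta>\<bar>)"
    have "0 < \<theta>" using \<theta> pi_gt_zero by linarith
    then have "0 < 2 * C"
      using c0 by (auto simp: C_def intro!: mult_pos_pos add_pos_nonneg)
    then show ?thesis
      using solution_smoothing[OF _ _ \<open>dirichlet_eigensystem \<Omega> lam \<phi>\<close> _ _ _ _ C_def]
      by (intro exI[of _ "2 * C"]) auto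
  qed
  have "\<forall>\<^sub>F \<theta> in at_right (pi / 2). pi / 2 < \<theta> \<and> \<theta> < \<tau>"
    using eventually_at_right_real[OF \<open>pi / 2 < \<tau>\<close>] by (simp add: greaterThanLessThan_iff)
  then show ?thesis
  proof eventually_elim
    case (elim \<theta>)
    show ?case
      using eventually_gt_at_top[of "(2 * M + 2) / (cos \<theta> - cos \<tau>)"]
      by eventually_elim (rule bound, use elim in auto)
  qed
qed

end
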